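(* Let $2\leq k$, $n\geq 2k$, and let $(J(n,k),\mathcal{P})$ be an $A_n$-primitive decomposition such that $A_n$ is arc-transitive on $J(n,k)$. Then either $\mathcal{P}$ is an $S_n$-primitive decomposition, or one of the following holds: (a) $(n,k)=(5,2)$ and $(J(5,2),\mathcal{P})$ is isomorphic to $(J(5,2),\mathcal{P}_1)$, where $\mathcal{P}_1=\{P_1^g\mid g\in A_5\}$ and $P_1=\{\{1,2\},\{2,3\}\}^{H_1}$ with $H_1=\langle(1,2,3,4,5),(1,3)(4,5)\rangle$; (b) $(n,k)=(6,3)$ and $(J(6,3),\mathcal{P})$ is isomorphic to $(J(6,3),\mathcal{P}_2)$, where $\mathcal{P}_2=\{P_2^g\mid g\in A_6\}$ and $P_2=\{\{1,2,3\},\{2,3,4\}\}^{H_2}$ with $H_2=\langle(2,3)(5,6),(1,4,5)(2,3,6)\rangle\cong\mathrm{PSL}(2,5)$.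
   Context: $J(n,k)$ has vertices the $k$-subsets of $X=\{1,\dots,n\}$, adjacent when they share $k-1$ points; $S_n$ and $A_n$ act naturally. A decomposition is a partition of the edge set into at least two parts; for a group $L$ of automorphisms it is $L$-primitive if $L$ preserves it and acts primitively (in particular transitively) on the parts. For an edge $e$ and subgroup $H$, $e^H$ is the $H$-orbit of $e$. Two decompositions $\mathcal{P}_1,\mathcal{P}_2$ of $\Gamma$ are isomorphic if there is $g\in\mathrm{Aut}(\Gamma)$ with $\mathcal{P}_1^g=\mathcal{P}_2$. *)

theory Defs
  imports
    "HOL-Analysis.Analysis"
    "HOL-Library.Numeral_Type"
    "HOL-Algebra.Algebra"
begin

section \<open>Graphs and group actions on them\<close>

text \<open>An edge is the set of its two ends, so a set of edges has type \<^typ>\<open>'v set set\<close> and a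
  decomposition has type \<^typ>\<open>'v set set set\<close>.  Following the library's treatment of group
  actions, a permutation of a set is extensional, i.e. an element of \<^const>\<open>Bij\<close>.\<close>

record 'v ugraph =
  verts :: "'v set"
  edges :: "'v set set"

definition arcs :: "'v ugraph \<Rightarrow> ('v \<times> 'v) set" where
  "arcs \<Gamma> = {(u, v). u \<in> verts \<Gamma> \<and> v \<in> verts \<Gamma> \<and> u \<noteq> v \<and> {u, v} \<in> edges \<Gamma>}"

definition graph_aut :: "'v ugraph \<Rightarrow> ('v \<Rightarrow> 'v) set" where
  "graph_aut \<Gamma> = {g \<in> Bij (verts \<Gamma>).
     \<forall>u \<in> verts \<Gamma>. \<forall>v \<in> verts \<Gamma>. {g u, g v} \<in> edges \<Gamma> \<longleftrightarrow> {u, v} \<in> edges \<Gamma>}"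

text \<open>An abstract group \<open>G\<close> together with a homomorphism \<open>\<phi>\<close> into the automorphism group
  of the graph.\<close>

definition acts_on_graph ::
    "('g, 'm) monoid_scheme \<Rightarrow> ('g \<Rightarrow> 'v \<Rightarrow> 'v) \<Rightarrow> 'v ugraph \<Rightarrow> bool" where
  "acts_on_graph G \<phi> \<Gamma> \<longleftrightarrow>
     group_action G (verts \<Gamma>) \<phi> \<and> (\<forall>g \<in> carrier G. \<phi> g \<in> graph_aut \<Gamma>)"

definition arc_transitive ::
    "('g, 'm) monoid_scheme \<Rightarrow> ('g \<Rightarrow> 'v \<Rightarrow> 'v) \<Rightarrow> 'v ugraph \<Rightarrow> bool" where
  "arc_transitive G \<phi> \<Gamma> \<longleftrightarrow> acts_on_graph G \<phi> \<Gamma> \<and>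
     (\<forall>(u, v) \<in> arcs \<Gamma>. \<forall>(x, y) \<in> arcs \<Gamma>. \<exists>g \<in> carrier G. \<phi> g u = x \<and> \<phi> g v = y)"

text \<open>Primitivity: the action is transitive and the only invariant partitions are the two
  trivial ones.\<close>

definition primitive_action ::
    "('g, 'm) monoid_scheme \<Rightarrow> 'x set \<Rightarrow> ('g \<Rightarrow> 'x \<Rightarrow> 'x) \<Rightarrow> bool" where
  "primitive_action G S \<phi> \<longleftrightarrow> transitive_action G S \<phi> \<and>
     (\<forall>B. partition_on S B \<and> (\<forall>g \<in> carrier G. \<forall>b \<in> B. \<phi> g ` b \<in> B)
        \<longrightarrow> B = {S} \<or> B = (\<lambda>x. {x}) ` S)"

section \<open>Decompositions\<close>

definition decomposition :: "'v ugraph \<Rightarrow> 'v set set set \<Rightarrow> bool" where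
  "decomposition \<Gamma> \<P> \<longleftrightarrow> partition_on (edges \<Gamma>) \<P> \<and> (\<exists>P \<in> \<P>. \<exists>Q \<in> \<P>. P \<noteq> Q)"

definition edge_act :: "('g \<Rightarrow> 'v \<Rightarrow> 'v) \<Rightarrow> 'g \<Rightarrow> 'v set \<Rightarrow> 'v set" where
  "edge_act \<phi> g e = \<phi> g ` e"

definition part_act :: "('g \<Rightarrow> 'v \<Rightarrow> 'v) \<Rightarrow> 'g \<Rightarrow> 'v set set \<Rightarrow> 'v set set" where
  "part_act \<phi> g P = edge_act \<phi> g ` P"

definition primitive_decomposition ::
    "('g, 'm) monoid_scheme \<Rightarrow> ('g \<Rightarrow> 'v \<Rightarrow> 'v) \<Rightarrow> 'v ugraph \<Rightarrow> 'v set set set \<Rightarrow> bool" where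
  "primitive_decomposition G \<phi> \<Gamma> \<P> \<longleftrightarrow>
     acts_on_graph G \<phi> \<Gamma> \<and> decomposition \<Gamma> \<P> \<and>
     (\<forall>g \<in> carrier G. \<forall>P \<in> \<P>. part_act \<phi> g P \<in> \<P>) \<and>
     primitive_action G \<P> (\<lambda>g. restrict (part_act \<phi> g) \<P>)"

definition isomorphic_decompositions ::
    "'v ugraph \<Rightarrow> 'v set set set \<Rightarrow> 'v set set set \<Rightarrow> bool" where
  "isomorphic_decompositions \<Gamma> \<P> \<Q> \<longleftrightarrow>
     (\<exists>g \<in> graph_aut \<Gamma>. (\<lambda>P. (\<lambda>e. g ` e) ` P) ` \<P> = \<Q>)"

section \<open>Johnson graphs\<close>

definition johnson :: "nat \<Rightarrow> nat \<Rightarrow> nat set ugraph" where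
  "johnson n k =
     (let V = {A. A \<subseteq> {1..n} \<and> card A = k}
      in \<lparr>verts = V,
          edges = {{A, B} | A B. A \<in> V \<and> B \<in> V \<and> A \<noteq> B \<and> card (A \<inter> B) = k - 1}\<rparr>)"

definition johnson_act :: "nat \<Rightarrow> nat \<Rightarrow> (nat \<Rightarrow> nat) \<Rightarrow> nat set \<Rightarrow> nat set" where
  "johnson_act n k p = restrict (\<lambda>A. p ` A) (verts (johnson n k))"

section \<open>The two exceptional decompositions\<close>

definition H\<^sub>1 :: "(nat \<Rightarrow> nat) monoid" where
  "H\<^sub>1 = subgroup_generated (sym_group 5)
     {cycle_of_list [1, 2, 3, 4, 5],
      cycle_of_list [1, 3] \<circ> cycle_of_list [4, 5]}"

definition P\<^sub>1 :: "nat set set set" where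
  "P\<^sub>1 = orbit H\<^sub>1 (edge_act (johnson_act 5 2)) {{1, 2}, {2, 3}}"

definition \<P>\<^sub>1 :: "nat set set set set" where
  "\<P>\<^sub>1 = orbit (alt_group 5) (part_act (johnson_act 5 2)) P\<^sub>1"

definition H\<^sub>2 :: "(nat \<Rightarrow> nat) monoid" where
  "H\<^sub>2 = subgroup_generated (sym_group 6)
     {cycle_of_list [2, 3] \<circ> cycle_of_list [5, 6],
      cycle_of_list [1, 4, 5] \<circ> cycle_of_list [2, 3, 6]}"

definition P\<^sub>2 :: "nat set set set" where
  "P\<^sub>2 = orbit H\<^sub>2 (edge_act (johnson_act 6 3)) {{1, 2, 3}, {2, 3, 4}}"

definition \<P>\<^sub>2 :: "nat set set set set" where
  "\<P>\<^sub>2 = orbit (alt_group 6) (part_act (johnson_act 6 3)) P\<^sub>2"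

section \<open>Projective special linear groups\<close>

definition SL :: "('a::comm_ring_1 ^ 'n ^ 'n) monoid" where
  "SL = \<lparr>carrier = {A. det A = 1}, mult = (**), one = mat 1\<rparr>"

definition group_center :: "('g, 'm) monoid_scheme \<Rightarrow> 'g set" where
  "group_center G = {z \<in> carrier G. \<forall>g \<in> carrier G. z \<otimes>\<^bsub>G\<^esub> g = g \<otimes>\<^bsub>G\<^esub> z}"

definition PSL :: "('a::comm_ring_1 ^ 'n ^ 'n) set monoid" where
  "PSL = SL Mod group_center SL"

text \<open>The ring structure on the numeral type \<^typ>\<open>5\<close> is arithmetic modulo 5, so \<^typ>\<open>5\<close> is
  the field of order five.\<close>

abbreviation PSL_2_5 :: "(5 ^ 2 ^ 2) set monoid" where
  "PSL_2_5 \<equiv> PSL"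

end

theory Submission
  imports Defs
begin

text \<open>Let \<open>e\<close> be an edge, \<open>P\<close> the part containing it and \<open>H\<close> the stabilizer of \<open>P\<close> in the
  alternating group; by primitivity \<open>H\<close> is a maximal subgroup, and it contains the stabilizer of
  \<open>e\<close>.  The latter preserves a partition of the points into three cells and contains every product
  of two transpositions within the cells, so all such transpositions are congruent modulo \<open>H\<close>.
  The decomposition is invariant under the symmetric group as soon as one of these transpositions
  normalizes \<open>H\<close>.  Call an element of \<open>H\<close> good if it conjugates a transposition within a cell to
  one congruent to it.  A bad element maps points whose transposition is congruent to those of the
  cells to points whose transposition is not, and counting
  the points of the largest cell forces \<open>(n, k)\<close> to be \<open>(5, 2)\<close> or \<open>(6, 3)\<close>.  In these cases the
  involution swapping the points of each two-point cell has conjugates under \<open>H\<close> which agree on a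
  moved point only if they are equal.  So either \<open>n = 5\<close> and \<open>H\<close> fixes a point, or these
  conjugates are the reflections of a pentagon, respectively a total of
  five pairwise disjoint synthemes.  There are two possibilities for this set, interchanged by a
  transposition, and maximality identifies \<open>H\<close> with its stabilizer in the alternating group.\<close>

section \<open>Permutations acting on Johnson graphs\<close>

text \<open>No single transposition is even, so a transposition can be tested against
  \<open>H\<close> only in a product of two; hence congruence modulo \<open>H\<close>, and hence
  goodness, which asks whether conjugation keeps the common class. A transposition within a cell
  fixes \<open>e0\<close>, and \<open>P0\<close> is the orbit of \<open>e0\<close> under
  \<open>H\<close>; normalizing \<open>H\<close> is therefore enough for it to fix
  \<open>P0\<close>, and one odd element fixing \<open>P0\<close> makes the whole symmetric group
  preserve the decomposition. The numerical bound comes from there being only three cells: a bad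
  element sends related points to different cells, so three related points already meet every cell,
  and this is contradictory once the outer cell \<open>{k + 2..n}\<close> has three points. What
  survives is \<open>n = k + 3\<close>, which with \<open>2 * k \<le> n\<close> and
  \<open>5 \<le> n\<close> leaves the two exceptional pairs. The transposition of the last two
  points interchanges the two possible sets of involutions and fixes \<open>e0\<close>, but it is
  odd. The two candidates for \<open>H\<close> are thus conjugate by a graph automorphism outside
  the alternating group, so the conclusion is an isomorphism and not an equality.\<close>

definition act :: "('a \<Rightarrow> 'a) \<Rightarrow> 'a set set \<Rightarrow> 'a set set" where
  "act p e = (`) p ` e"

lemma act_comp: "act (p \<circ> q) e = act p (act q e)"
  by (simp add: act_def image_comp image_image)

lemma act_id [simp]: "act id e = e"
  by (simp add: act_def)

lemma act_image_comp: "act (p \<circ> q) ` P = act p ` act q ` P"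
  by (simp add: image_image act_comp)

lemma act_image_id [simp]: "act id ` P = P"
  by simp

lemma act_inv_act: "p permutes S \<Longrightarrow> act (inv' p) (act p e) = e"
  by (metis act_comp act_id permutes_inv_o(2))

lemma act_act_inv: "p permutes S \<Longrightarrow> act p (act (inv' p) e) = e"
  by (metis act_comp act_id permutes_inv_o(1))

lemma act_image_inv: "p permutes S \<Longrightarrow> act (inv' p) ` act p ` P = P"
  by (metis act_image_comp act_image_id permutes_inv_o(2))

lemma verts_johnson: "A \<in> verts (johnson n k) \<longleftrightarrow> A \<subseteq> {1..n} \<and> card A = k"
  by (simp add: johnson_def)

lemma edges_johnson: "e \<in> edges (johnson n k) \<longleftrightarrow>
    (\<exists>A B. e = {A, B} \<and> A \<in> verts (johnson n k) \<and> B \<in> verts (johnson n k) \<and> A \<noteq> B \<and> card (A \<inter> B) = k - 1)"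
  by (auto simp add: johnson_def)

lemma edge_subset_verts: "e \<in> edges (johnson n k) \<Longrightarrow> e \<subseteq> verts (johnson n k)"
  by (auto simp: edges_johnson)

lemma image_verts:
  assumes "p permutes {1..n}" "A \<in> verts (johnson n k)"
  shows "p ` A \<in> verts (johnson n k)"
  using assms permutes_image[OF assms(1)]
  by (auto simp: verts_johnson card_image permutes_inj_on)

lemma act_edges:
  assumes p: "p permutes {1..n}" and "e \<in> edges (johnson n k)"
  shows "act p e \<in> edges (johnson n k)"
proof -
  obtain A B where e: "e = {A, B}" "A \<in> verts (johnson n k)" "B \<in> verts (johnson n k)" "A \<noteq> B"
    "card (A \<inter> B) = k - 1"
    using assms(2) by (auto simp: edges_johnson)
  have "p ` A \<inter> p ` B = p ` (A \<inter> B)"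
    using p by (simp add: image_Int permutes_inj)
  moreover have "p ` A \<noteq> p ` B"
    using e(4) p by (simp add: inj_image_eq_iff permutes_inj)
  ultimately show ?thesis
    unfolding edges_johnson
    using e image_verts[OF p e(2)] image_verts[OF p e(3)] card_image[OF permutes_inj_on[OF p], of "A \<inter> B"]
    by (intro exI[of _ "p ` A"] exI[of _ "p ` B"]) (simp add: act_def)
qed

lemma johnson_act_Bij:
  assumes "p permutes {1..n}" shows "johnson_act n k p \<in> Bij (verts (johnson n k))"
proof -
  have "bij_betw (\<lambda>A. p ` A) (verts (johnson n k)) (verts (johnson n k))"
    using assms permutes_inv[OF assms]
    by (intro bij_betw_byWitness[where f' = "\<lambda>A. inv' p ` A"])
      (auto simp: image_verts image_image permutes_inverses)
  then show ?thesis
    by (simp add: Bij_def johnson_act_def)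
qed

lemma johnson_act_aut:
  assumes "p permutes {1..n}" shows "johnson_act n k p \<in> graph_aut (johnson n k)"
proof -
  have "{p ` u, p ` v} \<in> edges (johnson n k) \<longleftrightarrow> {u, v} \<in> edges (johnson n k)" for u v
  proof -
    have "act p {u, v} \<in> edges (johnson n k) \<longleftrightarrow> {u, v} \<in> edges (johnson n k)"
      using act_edges[OF assms, of "{u, v}"] act_edges[OF permutes_inv[OF assms], of "act p {u, v}"]
      by (auto simp: act_inv_act[OF assms])
    then show ?thesis by (simp add: act_def)
  qed
  then show ?thesis
    using johnson_act_Bij[OF assms] by (auto simp: graph_aut_def johnson_act_def)
qed

lemma acts_on_johnson: "acts_on_graph (sym_group n) (johnson_act n k) (johnson n k)"
proof -
  have "johnson_act n k \<in> hom (sym_group n) (BijGroup (verts (johnson n k)))"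
  proof (rule homI)
    fix p q assume "p \<in> carrier (sym_group n)" "q \<in> carrier (sym_group n)"
    then have p: "p permutes {1..n}" "q permutes {1..n}" by (auto simp: sym_group_carrier)
    have "johnson_act n k (p \<circ> q) = compose (verts (johnson n k)) (johnson_act n k p) (johnson_act n k q)"
      using p by (intro ext) (simp add: compose_def johnson_act_def image_verts image_comp)
    then show "johnson_act n k (p \<otimes>\<^bsub>sym_group n\<^esub> q) =
        johnson_act n k p \<otimes>\<^bsub>BijGroup (verts (johnson n k))\<^esub> johnson_act n k q"
      using p by (simp add: BijGroup_def johnson_act_Bij sym_group_mult)
  qed (simp add: BijGroup_def johnson_act_Bij sym_group_carrier)
  then show ?thesis
    by (simp add: acts_on_graph_def group_action_def group_hom_def group_hom_axioms_def
        sym_group_is_group group_BijGroup johnson_act_aut sym_group_carrier)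
qed

lemma edge_act_johnson:
  assumes "e \<in> edges (johnson n k)" shows "edge_act (johnson_act n k) p e = act p e"
  unfolding edge_act_def act_def
  using edge_subset_verts[OF assms] by (intro image_cong) (auto simp: johnson_act_def)

lemma part_act_johnson:
  assumes "P \<subseteq> edges (johnson n k)" shows "part_act (johnson_act n k) p P = act p ` P"
  unfolding part_act_def using assms edge_act_johnson by (intro image_cong) auto

text \<open>The unqualified name would denote the transpose of a matrix.\<close>

abbreviation tr :: "'a \<Rightarrow> 'a \<Rightarrow> 'a \<Rightarrow> 'a" where "tr \<equiv> Transposition.transpose"

lemma conj_transpose:
  assumes "p permutes S"
  shows "p \<circ> tr x y \<circ> inv' p = tr (p x) (p y)"
proof
  fix z
  show "(p \<circ> tr x y \<circ> inv' p) z = tr (p x) (p y) z"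
    using transpose_apply_commute[OF permutes_bij[OF assms], of "p x" "p y" "inv' p z"]
    by (simp add: permutes_inverses[OF assms])
qed

section \<open>Decompositions invariant under the alternating group\<close>

locale alt_primitive =
  fixes n k :: nat and \<P> :: "nat set set set set"
  assumes k2: "2 \<le> k" and n2k: "2 * k \<le> n"
    and prim: "primitive_decomposition (alt_group n) (johnson_act n k) (johnson n k) \<P>"
    and arc_trans: "arc_transitive (alt_group n) (johnson_act n k) (johnson n k)"
begin

section \<open>Parts, the stabilizer of a part and its maximality\<close>

lemma partition: "partition_on (edges (johnson n k)) \<P>"
  using prim by (auto simp: primitive_decomposition_def decomposition_def)

lemma part_edges: "P \<in> \<P> \<Longrightarrow> P \<subseteq> edges (johnson n k)"
  using partition by (auto simp: partition_on_def)

lemma part_eqI: "P \<in> \<P> \<Longrightarrow> Q \<in> \<P> \<Longrightarrow> e \<in> P \<Longrightarrow> e \<in> Q \<Longrightarrow> P = Q"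
  using partition unfolding partition_on_def disjoint_def by blast

lemma alt_part:
  assumes "p \<in> carrier (alt_group n)" "P \<in> \<P>" shows "act p ` P \<in> \<P>"
  using prim assms part_act_johnson[OF part_edges[OF assms(2)], of p]
  unfolding primitive_decomposition_def by metis

lemma edge_transitive:
  assumes "e \<in> edges (johnson n k)" "f \<in> edges (johnson n k)"
  shows "\<exists>p \<in> carrier (alt_group n). act p e = f"
proof -
  obtain A B where e: "e = {A, B}" "A \<in> verts (johnson n k)" "B \<in> verts (johnson n k)" "A \<noteq> B"
    using assms(1) by (auto simp: edges_johnson)
  obtain C D where f: "f = {C, D}" "C \<in> verts (johnson n k)" "D \<in> verts (johnson n k)" "C \<noteq> D"
    using assms(2) by (auto simp: edges_johnson)
  have "(A, B) \<in> arcs (johnson n k)" "(C, D) \<in> arcs (johnson n k)"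
    using assms e f by (auto simp: arcs_def)
  then obtain p where "p \<in> carrier (alt_group n)" "johnson_act n k p A = C" "johnson_act n k p B = D"
    using arc_trans unfolding arc_transitive_def by fastforce
  then show ?thesis
    using e f by (intro bexI[of _ p]) (auto simp: act_def johnson_act_def)
qed

text \<open>For \<open>k = 2\<close> and \<open>k = 3\<close> this is the edge from which
  \<open>P\<^sub>1\<close> and \<open>P\<^sub>2\<close> are built.\<close>

definition e0 :: "nat set set" where "e0 = {{1..k}, {2..k + 1}}"

lemma e0_edge: "e0 \<in> edges (johnson n k)"
proof -
  have "{1..k} \<inter> {2..k + 1} = {2..k}" by auto
  moreover have "{1..k} \<noteq> {2..k + 1}" using k2 by (metis atLeastAtMost_iff one_le_numeral le_trans numeral_le_one_iff semiring_norm(69) order_refl)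
  ultimately show ?thesis
    unfolding edges_johnson e0_def
    using k2 n2k by (intro exI[of _ "{1..k}"] exI[of _ "{2..k + 1}"]) (auto simp: verts_johnson)
qed

definition P0 :: "nat set set set" where "P0 = (THE P. P \<in> \<P> \<and> e0 \<in> P)"

lemma P0: "P0 \<in> \<P>" "e0 \<in> P0"
proof -
  obtain P where P: "P \<in> \<P>" "e0 \<in> P"
    using partition e0_edge by (auto simp: partition_on_def)
  then have "\<exists>!P. P \<in> \<P> \<and> e0 \<in> P" using part_eqI by blast
  from theI'[OF this] show "P0 \<in> \<P>" "e0 \<in> P0" by (auto simp: P0_def)
qed

definition H :: "(nat \<Rightarrow> nat) set" where
  "H = {p \<in> carrier (alt_group n). act p ` P0 = P0}"

lemma H_alt: "p \<in> H \<Longrightarrow> p \<in> carrier (alt_group n)"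
  by (simp add: H_def)

lemma H_permutes: "p \<in> H \<Longrightarrow> p permutes {1..n}"
  by (simp add: H_def alt_group_carrier)

lemma alt_comp: "p \<in> carrier (alt_group n) \<Longrightarrow> q \<in> carrier (alt_group n) \<Longrightarrow> p \<circ> q \<in> carrier (alt_group n)"
  by (metis alt_group_is_group alt_group_mult group.subgroup_self subgroup.m_closed)

lemma H_comp: "p \<in> H \<Longrightarrow> q \<in> H \<Longrightarrow> p \<circ> q \<in> H"
  by (auto simp: H_def alt_comp act_image_comp)

lemma H_id: "id \<in> H"
  by (simp add: H_def alt_group_carrier permutes_id)

lemma H_inv: "p \<in> H \<Longrightarrow> inv' p \<in> H"
  using act_image_inv[OF H_permutes, of p P0] alt_group_inv_closed[OF H_alt, of p]
  by (simp add: H_def)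

text \<open>Parts are disjoint and permuted, so one edge of \<open>P0\<close> that stays in
  \<open>P0\<close> takes the whole part along.\<close>

lemma H_iff: 
  assumes "p \<in> carrier (alt_group n)"
  shows "p \<in> H \<longleftrightarrow> act p e0 \<in> P0"
  using assms P0 part_eqI[OF alt_part[OF assms P0(1)] P0(1)] by (auto simp: H_def)

lemma P0_eq: "P0 = (\<lambda>p. act p e0) ` H"
proof -
  have "f \<in> (\<lambda>p. act p e0) ` H" if "f \<in> P0" for f
    using edge_transitive[OF e0_edge, of f] that part_edges[OF P0(1)] H_iff by blast
  then show ?thesis using H_iff H_alt by blast
qed

lemma parts_transitive:
  assumes "P \<in> \<P>" obtains p where "p \<in> carrier (alt_group n)" "P = act p ` P0"
proof -
  have "P \<noteq> {}"
    using assms partition by (auto simp: partition_on_def)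
  then obtain f where f: "f \<in> P" by blast
  then obtain p where p: "p \<in> carrier (alt_group n)" "act p e0 = f"
    using edge_transitive[OF e0_edge, of f] part_edges[OF assms] by blast
  then have "P = act p ` P0"
    using part_eqI[OF assms alt_part[OF p(1) P0(1)] f] P0(2) by blast
  then show ?thesis using p that by blast
qed

lemma parts_eq: "\<P> = (\<lambda>p. act p ` P0) ` carrier (alt_group n)"
  using alt_part[OF _ P0(1)] by (auto elim: parts_transitive)

text \<open>For a subgroup \<open>K\<close> above \<open>H\<close>, the sets of parts
  \<open>g K P0\<close> form an invariant partition of the parts. Primitivity leaves a single block,
  so that \<open>K\<close> is transitive on parts and contains a stabilizer, or singletons, so that
  \<open>K\<close> fixes \<open>P0\<close>.\<close>

lemma H_maximal:
  assumes K: "subgroup K (alt_group n)" and HK: "H \<subseteq> K"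
  shows "K = H \<or> K = carrier (alt_group n)"
proof -
  have Ka: "K \<subseteq> carrier (alt_group n)" using K by (rule subgroup.subset)
  have Kc: "p \<circ> q \<in> K" if "p \<in> K" "q \<in> K" for p q
    using subgroup.m_closed[OF K that] by (simp add: alt_group_mult)
  have Ki: "inv' p \<in> K" if "p \<in> K" for p
    using subgroup.m_inv_closed[OF K that] Ka that by (metis alt_group_inv_equality subsetD)
  have Kid: "id \<in> K" using H_id HK by blast
  define B where "B = (\<lambda>g. (\<lambda>p. act (g \<circ> p) ` P0) ` K) ` carrier (alt_group n)"
  have block: "g \<circ> p \<in> carrier (alt_group n)" if "g \<in> carrier (alt_group n)" "p \<in> K" for g p
    using that Ka alt_comp by blast
  \<comment> \<open>Elements taking \<open>P0\<close> to the same part differ by an element of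
    \<open>H\<close>, which \<open>K\<close> absorbs; lying in the block of \<open>h\<close> thus
    means lying in the coset \<open>h K\<close>.\<close>
  have mem: "act g ` P0 \<in> b \<Longrightarrow> \<exists>p\<in>K. g = h \<circ> p" 
    if b: "b = (\<lambda>p. act (h \<circ> p) ` P0) ` K" and gh: "g \<in> carrier (alt_group n)" "h \<in> carrier (alt_group n)" for g h b
  proof -
    assume "act g ` P0 \<in> b"
    then obtain p where p: "p \<in> K" "act g ` P0 = act (h \<circ> p) ` P0" using b by auto
    have hp: "h \<circ> p permutes {1..n}" "g permutes {1..n}"
      using block[OF gh(2) p(1)] gh(1) by (auto simp: alt_group_carrier)
    have "act (inv' (h \<circ> p) \<circ> g) ` P0 = P0"
      unfolding act_image_comp p(2) using hp(1) by (simp only: act_image_comp[symmetric] permutes_inv_o) simp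
    moreover have "inv' (h \<circ> p) \<circ> g \<in> carrier (alt_group n)"
      using gh(1) block[OF gh(2) p(1)] alt_comp alt_group_inv_closed by blast
    ultimately have "inv' (h \<circ> p) \<circ> g \<in> K" using HK by (auto simp: H_def)
    moreover have "g = h \<circ> (p \<circ> (inv' (h \<circ> p) \<circ> g))"
      using permutes_inv_o(1)[OF hp(1)] by (simp add: comp_assoc[symmetric])
    ultimately show ?thesis using Kc p(1) by blast
  qed
  have part: "partition_on \<P> B"
  proof (rule partition_onI)
    show "\<Union> B = \<P>"
    proof
      show "\<Union> B \<subseteq> \<P>" unfolding B_def using alt_part[OF block P0(1)] by blast
      show "\<P> \<subseteq> \<Union> B"
      proof
        fix P assume "P \<in> \<P>"
        then obtain g where g: "g \<in> carrier (alt_group n)" "P = act (g \<circ> id) ` P0"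
          using parts_transitive by (metis comp_id)
        then show "P \<in> \<Union> B" unfolding B_def using Kid by blast
      qed
    qed
  next
    fix b c assume bc: "b \<in> B" "c \<in> B" "b \<noteq> c"
    show "disjnt b c"
    proof (rule ccontr)
      assume "\<not> disjnt b c"
      obtain g h where g: "g \<in> carrier (alt_group n)" "b = (\<lambda>p. act (g \<circ> p) ` P0) ` K"
        and h: "h \<in> carrier (alt_group n)" "c = (\<lambda>p. act (h \<circ> p) ` P0) ` K"
        using bc by (auto simp: B_def)
      obtain p where p: "p \<in> K" "act (g \<circ> p) ` P0 \<in> c"
        using \<open>\<not> disjnt b c\<close> g(2) by (auto simp: disjnt_def)
      from mem[OF h(2) block[OF g(1) p(1)] h(1) p(2)] obtain q where q: "q \<in> K" "g \<circ> p = h \<circ> q" by blast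
      have pp: "p permutes {1..n}" "q permutes {1..n}" using p q Ka by (auto simp: alt_group_carrier)
      have gq: "g = h \<circ> (q \<circ> inv' p)"
        using q(2) permutes_inv_o(1)[OF pp(1)] by (metis comp_assoc comp_id)
      have hp: "h = g \<circ> (p \<circ> inv' q)"
        using q(2) permutes_inv_o(1)[OF pp(2)] by (metis comp_assoc comp_id)
      have "b \<subseteq> c"
      proof
        fix x assume "x \<in> b"
        then obtain r where r: "r \<in> K" "x = act (g \<circ> r) ` P0" using g by auto
        have "x = act (h \<circ> (q \<circ> inv' p \<circ> r)) ` P0" unfolding r(2) by (subst gq) (simp add: comp_assoc)
        moreover have "q \<circ> inv' p \<circ> r \<in> K" using Kc Ki p q r by simp
        ultimately show "x \<in> c" unfolding h(2) by (rule image_eqI)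
      qed
      moreover have "c \<subseteq> b"
      proof
        fix x assume "x \<in> c"
        then obtain r where r: "r \<in> K" "x = act (h \<circ> r) ` P0" using h by auto
        have "x = act (g \<circ> (p \<circ> inv' q \<circ> r)) ` P0" unfolding r(2) by (subst hp) (simp add: comp_assoc)
        moreover have "p \<circ> inv' q \<circ> r \<in> K" using Kc Ki p q r by simp
        ultimately show "x \<in> b" unfolding g(2) by (rule image_eqI)
      qed
      ultimately show False using bc(3) by blast
    qed
  next
    show "{} \<notin> B" using Kid by (auto simp: B_def)
  qed
  have inv: "restrict (part_act (johnson_act n k) g) \<P> ` b \<in> B"
    if g: "g \<in> carrier (alt_group n)" and b: "b \<in> B" for g b
  proof -
    have "b \<subseteq> \<P>" using part b by (auto simp: partition_on_def)
    then have "restrict (part_act (johnson_act n k) g) \<P> ` b = (\<lambda>P. act g ` P) ` b"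
      by (intro image_cong refl) (metis part_act_johnson part_edges restrict_apply' subsetD)
    moreover obtain h where h: "h \<in> carrier (alt_group n)" "b = (\<lambda>p. act (h \<circ> p) ` P0) ` K"
      using b by (auto simp: B_def)
    ultimately have "restrict (part_act (johnson_act n k) g) \<P> ` b = (\<lambda>p. act ((g \<circ> h) \<circ> p) ` P0) ` K"
      by (simp add: image_image act_comp)
    then show ?thesis unfolding B_def using alt_comp[OF g h(1)] by blast
  qed
  have "primitive_action (alt_group n) \<P> (\<lambda>g. restrict (part_act (johnson_act n k) g) \<P>)"
    using prim by (simp add: primitive_decomposition_def)
  then have "B = {\<P>} \<or> B = (\<lambda>x. {x}) ` \<P>"
    unfolding primitive_action_def using part inv by blast
  moreover have b0: "(\<lambda>p. act p ` P0) ` K \<in> B"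
    unfolding B_def by (rule image_eqI[of _ _ id]) (auto simp: alt_group_carrier permutes_id)
  moreover have "K = carrier (alt_group n)" if "B = {\<P>}"
  proof -
    have "\<P> = (\<lambda>p. act (id \<circ> p) ` P0) ` K" using that b0 by auto
    then have "g \<in> K" if g: "g \<in> carrier (alt_group n)" for g
      using mem[OF _ g, of _ id] alt_part[OF g P0(1)] by (auto simp: alt_group_carrier permutes_id)
    then show ?thesis using Ka by blast
  qed
  moreover have "K = H" if single: "B = (\<lambda>x. {x}) ` \<P>"
  proof -
    obtain P where "(\<lambda>p. act p ` P0) ` K = {P}" using single b0 by auto
    then have all: "act p ` P0 = P" if "p \<in> K" for p using imageI[OF that, of "\<lambda>p. act p ` P0"] by simp
    then have "act p ` P0 = P0" if "p \<in> K" for p using that all[OF Kid] by simp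
    then show ?thesis using HK Ka by (auto simp: H_def)
  qed
  ultimately show ?thesis by blast
qed

text \<open>Each part is \<open>p P0\<close> with \<open>p\<close> even, and \<open>t\<close> may be
  inserted before \<open>P0\<close>; for odd \<open>g\<close> the product
  \<open>g \<circ> p \<circ> t\<close> is even, so \<open>g\<close> also permutes the parts.
  Transitivity and the absence of blocks are inherited from the alternating group.\<close>

lemma sym_primitiveI:
  assumes odd: "t permutes {1..n}" "\<not> evenperm t" and tP: "act t ` P0 = P0"
  shows "primitive_decomposition (sym_group n) (johnson_act n k) (johnson n k) \<P>"
proof -
  have perm: "act g ` P \<in> \<P>" if g: "g permutes {1..n}" and P: "P \<in> \<P>" for g P
  proof (cases "evenperm g")
    case True
    then show ?thesis using alt_part P g by (simp add: alt_group_carrier)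
  next
    case False
    obtain p where p: "p \<in> carrier (alt_group n)" "P = act p ` P0"
      using parts_transitive[OF P] by blast
    have pp: "p permutes {1..n}" "evenperm p" using p by (auto simp: alt_group_carrier)
    have "permutation g" "permutation t" "permutation p"
      using g odd pp permutation_permutes by blast+
    then have "g \<circ> p \<circ> t \<in> carrier (alt_group n)"
      using False g odd pp by (simp add: alt_group_carrier permutes_compose evenperm_comp permutation_compose)
    from alt_part[OF this P0(1)] have "act (g \<circ> p \<circ> t) ` P0 \<in> \<P>" .
    then show ?thesis by (simp add: p(2) act_image_comp tP)
  qed
  have restr: "restrict (part_act (johnson_act n k) g) \<P> = restrict (\<lambda>P. act g ` P) \<P>" for g
    by (auto simp: fun_eq_iff part_act_johnson part_edges)
  have Bij: "restrict (\<lambda>P. act g ` P) \<P> \<in> Bij \<P>" if g: "g permutes {1..n}" for g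
  proof -
    have "bij_betw (\<lambda>P. act g ` P) \<P> \<P>"
      using perm[OF g] perm[OF permutes_inv[OF g]]
      by (intro bij_betw_byWitness[where f' = "\<lambda>P. act (inv' g) ` P"])
        (auto simp: image_image act_act_inv[OF g] act_inv_act[OF g])
    then show ?thesis by (simp add: Bij_def)
  qed
  have hom: "(\<lambda>g. restrict (part_act (johnson_act n k) g) \<P>) \<in> hom (sym_group n) (BijGroup \<P>)"
  proof (rule homI)
    fix p q assume "p \<in> carrier (sym_group n)" "q \<in> carrier (sym_group n)"
    then have p: "p permutes {1..n}" "q permutes {1..n}" by (auto simp: sym_group_carrier)
    have "restrict (\<lambda>P. act (p \<circ> q) ` P) \<P> = compose \<P> (restrict (\<lambda>P. act p ` P) \<P>) (restrict (\<lambda>P. act q ` P) \<P>)"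
      using p by (intro ext) (simp add: compose_def perm act_image_comp)
    then show "restrict (part_act (johnson_act n k) (p \<otimes>\<^bsub>sym_group n\<^esub> q)) \<P> =
        restrict (part_act (johnson_act n k) p) \<P> \<otimes>\<^bsub>BijGroup \<P>\<^esub> restrict (part_act (johnson_act n k) q) \<P>"
      using p by (simp add: BijGroup_def Bij sym_group_mult restr)
  qed (simp add: BijGroup_def Bij sym_group_carrier restr)
  have "transitive_action (sym_group n) \<P> (\<lambda>g. restrict (part_act (johnson_act n k) g) \<P>)"
  proof (intro transitive_action.intro transitive_action_axioms.intro group_action.intro)
    show "group_hom (sym_group n) (BijGroup \<P>) (\<lambda>g. restrict (part_act (johnson_act n k) g) \<P>)"
      by (simp add: group_hom_def group_hom_axioms_def sym_group_is_group group_BijGroup hom)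
  next
    fix P Q assume PQ: "P \<in> \<P>" "Q \<in> \<P>"
    have "transitive_action (alt_group n) \<P> (\<lambda>g. restrict (part_act (johnson_act n k) g) \<P>)"
      using prim by (simp add: primitive_decomposition_def primitive_action_def)
    from transitive_action.unique_orbit[OF this PQ]
    show "\<exists>g\<in>carrier (sym_group n). restrict (part_act (johnson_act n k) g) \<P> P = Q"
      by (auto simp: alt_group_carrier sym_group_carrier)
  qed
  moreover have "B = {\<P>} \<or> B = (\<lambda>x. {x}) ` \<P>"
    if "partition_on \<P> B" "\<forall>g\<in>carrier (sym_group n). \<forall>b\<in>B. restrict (part_act (johnson_act n k) g) \<P> ` b \<in> B" for B
    using prim that by (auto simp: primitive_decomposition_def primitive_action_def alt_group_carrier sym_group_carrier)
  ultimately show ?thesis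
    using prim perm acts_on_johnson
    by (auto simp: primitive_decomposition_def primitive_action_def part_act_johnson part_edges sym_group_carrier)
qed

text \<open>As \<open>P0\<close> is the orbit of \<open>e0\<close> under \<open>H\<close> and
  \<open>t\<close> fixes \<open>e0\<close>, the image \<open>t P0\<close> is the orbit of
  \<open>e0\<close> under \<open>t H t\<close>.\<close>

lemma sym_primitive_if_normalizes:
  assumes odd: "t permutes {1..n}" "\<not> evenperm t" "t \<circ> t = id" and te: "act t e0 = e0"
    and norm: "\<And>h. h \<in> H \<Longrightarrow> t \<circ> h \<circ> t \<in> H"
  shows "primitive_decomposition (sym_group n) (johnson_act n k) (johnson n k) \<P>"
proof -
  have sub: "act t ` P0 \<subseteq> P0"
  proof
    fix f assume "f \<in> act t ` P0"
    then obtain h where h: "h \<in> H" "f = act t (act h e0)" using P0_eq by auto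
    then have "f = act (t \<circ> h \<circ> t) e0" by (simp add: act_comp te)
    then show "f \<in> P0" using norm[OF h(1)] H_iff H_alt by blast
  qed
  have "act t ` act t ` P0 = P0" unfolding act_image_comp[symmetric] odd(3) by simp
  then have "P0 \<subseteq> act t ` P0" using image_mono[OF sub, of "act t"] by simp
  with sub have "act t ` P0 = P0" by (rule equalityI)
  then show ?thesis using sym_primitiveI[OF odd(1,2)] by blast
qed

end

section \<open>Transpositions modulo the stabilizer of a part\<close>

lemma three_values:
  fixes a b c d :: nat
  assumes "a < 3" "b < 3" "c < 3" "a \<noteq> b" "a \<noteq> c" "b \<noteq> c" "d < 3"
  shows "a = d \<or> b = d \<or> c = d"
  using assms by linarith

lemma tr_tr_rotate:
  assumes "x \<noteq> y" "y \<noteq> z" "x \<noteq> z" shows "tr x y \<circ> tr y z = tr x z \<circ> tr x y"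
  using assms by (auto simp: fun_eq_iff Transposition.transpose_def)

lemma inv_tr_tr: "inv' (tr x y \<circ> tr z w) = tr z w \<circ> tr x y"
  by (simp add: o_inv_distrib)

lemma tr_tr_cancel: "f \<circ> tr x y \<circ> (tr x y \<circ> g) = f \<circ> g"
  by (simp add: fun_eq_iff)

context alt_primitive
begin

text \<open>A reference transposition: its two points lie in the last cell as soon as
  \<open>k + 3 \<le> n\<close>.\<close>

definition tau :: "nat \<Rightarrow> nat" where "tau = tr (n - 1) n"

text \<open>The cells are the symmetric difference of the ends of \<open>e0\<close>, their
  intersection and the complement of their union. Only points from \<open>1\<close> on are meant;
  \<open>0\<close> receives the value \<open>1\<close>.\<close>

definition cell :: "nat \<Rightarrow> nat" where
  "cell x = (if x = 1 \<or> x = k + 1 then 0 else if x \<le> k then 1 else 2)"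

text \<open>Transpositions are compared modulo \<open>H\<close>; the diagonal has to be added because \<open>tr x x\<close> is the
  identity.\<close>

definition rel :: "nat \<Rightarrow> nat \<Rightarrow> bool" where
  "rel x y \<longleftrightarrow> x = y \<or> tr x y \<circ> tau \<in> H"

text \<open>Conjugation by \<open>h\<close> turns \<open>tau\<close> into
  \<open>tr (h (n - 1)) (h n)\<close>; goodness says that the result is still congruent to
  \<open>tau\<close>.\<close>

definition good :: "(nat \<Rightarrow> nat) \<Rightarrow> bool" where
  "good h \<longleftrightarrow> rel (h (n - 1)) (h n)"

lemma tr_permutes: "x \<in> {1..n} \<Longrightarrow> y \<in> {1..n} \<Longrightarrow> tr x y permutes {1..n}"
  by (rule permutes_swap_id)

lemma tr_tr_alt:
  assumes "x \<in> {1..n}" "y \<in> {1..n}" "z \<in> {1..n}" "w \<in> {1..n}" "x \<noteq> y" "z \<noteq> w"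
  shows "tr x y \<circ> tr z w \<in> carrier (alt_group n)"
  using assms permutes_compose[OF tr_permutes[OF assms(3,4)] tr_permutes[OF assms(1,2)]]
  by (simp add: alt_group_carrier evenperm_comp permutation_swap_id evenperm_swap)

text \<open>Within the intersection or the outer cell both ends of \<open>e0\<close> are preserved;
  within the symmetric difference the ends are exchanged.\<close>

lemma act_tr_e0:
  assumes "cell x = cell y" "1 \<le> x" "1 \<le> y" shows "act (tr x y) e0 = e0"
proof (cases "cell x = 0")
  case False
  then have xy: "x \<noteq> 1" "x \<noteq> k + 1" by (auto simp: cell_def)
  have "cell y \<noteq> 0" using False assms(1) by simp
  then have yk: "y \<noteq> 1" "y \<noteq> k + 1" by (auto simp: cell_def)
  have "x \<le> k \<longleftrightarrow> y \<le> k"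
  proof -
    have "cell x = (if x \<le> k then 1 else 2)" using xy by (simp add: cell_def)
    moreover have "cell y = (if y \<le> k then 1 else 2)" using yk by (simp add: cell_def)
    ultimately show ?thesis using assms(1) by (cases "x \<le> k"; cases "y \<le> k") simp_all
  qed
  with xy yk have "x \<in> {1..k} \<longleftrightarrow> y \<in> {1..k}" "x \<in> {2..k + 1} \<longleftrightarrow> y \<in> {2..k + 1}"
    using assms(2,3) by auto
  then show ?thesis by (simp add: act_def e0_def)
next
  case True
  have swap: "tr 1 (k + 1) ` {1..k} = {2..k + 1}" "tr 1 (k + 1) ` {2..k + 1} = {1..k}"
  proof -
    show "tr 1 (k + 1) ` {1..k} = {2..k + 1}"
      by (auto simp: in_transpose_image_iff Transposition.transpose_def)
    then show "tr 1 (k + 1) ` {2..k + 1} = {1..k}"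
      by (metis image_comp image_id transpose_comp_involutory id_apply)
  qed
  from True assms have "x = y \<or> tr x y = tr 1 (k + 1)"
  proof -
    have "x = 1 \<or> x = k + 1" "y = 1 \<or> y = k + 1"
      using True assms(1) by (auto simp: cell_def split: if_split_asm)
    then show ?thesis by (metis transpose_commute)
  qed
  moreover have "act (tr 1 (k + 1)) e0 = e0"
    unfolding act_def e0_def image_insert image_empty swap by (rule insert_commute)
  ultimately show ?thesis by (metis act_id id_def transpose_same)
qed

lemma H_conj_tr:
  assumes "h \<in> H" "tr x y \<circ> tr z w \<in> H"
  shows "tr (h x) (h y) \<circ> tr (h z) (h w) \<in> H"
proof -
  note ph = H_permutes[OF assms(1)]
  have "h \<circ> (tr x y \<circ> tr z w) \<circ> inv' h = (h \<circ> tr x y \<circ> inv' h) \<circ> (h \<circ> tr z w \<circ> inv' h)"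
    by (simp add: fun_eq_iff permutes_inverses[OF ph])
  also have "\<dots> = tr (h x) (h y) \<circ> tr (h z) (h w)"
    by (simp add: conj_transpose[OF ph])
  finally show ?thesis using H_comp H_inv assms by metis
qed

lemma rel_sym: "rel x y \<Longrightarrow> rel y x"
  by (auto simp: rel_def transpose_commute)

end

text \<open>For \<open>n = 4\<close> and \<open>k = 2\<close> the last cell would be the single
  point \<open>4\<close>; from \<open>5\<close> on it contains both points of
  \<open>tau\<close>.\<close>

locale alt_primitive5 = alt_primitive +
  assumes n5: "5 \<le> n"
begin

lemma k3n: "k + 3 \<le> n"
  using k2 n2k n5 by linarith

lemma tau_points: "n - 1 \<in> {1..n}" "n \<in> {1..n}" "n - 1 \<noteq> n" "cell (n - 1) = 2" "cell n = 2"
  using k3n k2 by (auto simp: cell_def)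

lemma cell_tr_tr:
  assumes "x \<in> {1..n}" "y \<in> {1..n}" "z \<in> {1..n}" "w \<in> {1..n}" "x \<noteq> y" "z \<noteq> w"
    "cell x = cell y" "cell z = cell w"
  shows "tr x y \<circ> tr z w \<in> H"
  using H_iff[OF tr_tr_alt[OF assms(1-6)]] P0 act_tr_e0[OF assms(7)] act_tr_e0[OF assms(8)] assms(1-4)
  by (simp add: act_comp)

lemma cell_rel:
  assumes "x \<in> {1..n}" "y \<in> {1..n}" "cell x = cell y" shows "rel x y"
  using cell_tr_tr[OF assms(1,2) tau_points(1,2) _ tau_points(3) assms(3)] tau_points
  by (auto simp: rel_def tau_def)

lemma rel_cong:
  assumes "x \<noteq> y" "z \<noteq> w" "tr x y \<circ> tr z w \<in> H"
  shows "rel x y \<longleftrightarrow> rel z w"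
proof -
  have "tr z w \<circ> tr x y \<in> H" using H_inv[OF assms(3)] by (simp add: inv_tr_tr)
  then have "tr x y \<circ> tau \<in> H" if "tr z w \<circ> tau \<in> H"
    using H_comp[OF assms(3) that] by (simp add: tr_tr_cancel)
  moreover have "tr z w \<circ> tau \<in> H" if "tr x y \<circ> tau \<in> H"
    using H_comp[OF \<open>tr z w \<circ> tr x y \<in> H\<close> that] by (simp add: tr_tr_cancel)
  ultimately show ?thesis using assms by (auto simp: rel_def)
qed

lemma rel_tr_tr:
  assumes "x \<noteq> y" "z \<noteq> w" "rel x y" "rel z w" shows "tr x y \<circ> tr z w \<in> H"
proof -
  have "tr x y \<circ> tau \<in> H" "tr z w \<circ> tau \<in> H" using assms by (auto simp: rel_def)
  moreover have "inv' (tr z w \<circ> tau) = tau \<circ> tr z w" by (simp add: tau_def inv_tr_tr)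
  ultimately have "(tr x y \<circ> tau) \<circ> (tau \<circ> tr z w) \<in> H" using H_comp H_inv by metis
  then show ?thesis by (simp add: tau_def tr_tr_cancel)
qed

text \<open>The 3-cycle \<open>tr x y \<circ> tr y z\<close> lies in \<open>H\<close> and can be
  rewritten as \<open>tr x z \<circ> tr x y\<close>, which makes \<open>tr x z\<close> congruent to
  \<open>tr x y\<close>.\<close>

lemma rel_trans:
  assumes "rel x y" "rel y z" shows "rel x z"
proof (cases "x = y \<or> y = z \<or> x = z")
  case True
  then show ?thesis using assms by (auto simp: rel_def)
next
  case False
  then have "tr x z \<circ> tr x y \<in> H"
    using rel_tr_tr[of x y y z] assms tr_tr_rotate[of x y z] by simp
  then show ?thesis using rel_cong False assms by blast
qed

text \<open>Conjugating a product of two congruent transpositions by \<open>h\<close> stays in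
  \<open>H\<close>, so any related pair of distinct points can replace \<open>n - 1\<close> and
  \<open>n\<close> in testing goodness.\<close>

lemma good_iff:
  assumes h: "h \<in> H" and xy: "x \<noteq> y" "rel x y"
  shows "rel (h x) (h y) \<longleftrightarrow> good h"
proof -
  have "tr x y \<circ> tr (n - 1) n \<in> H" using xy by (simp add: rel_def tau_def)
  from H_conj_tr[OF h this] have "tr (h x) (h y) \<circ> tr (h (n - 1)) (h n) \<in> H" .
  moreover have "h x \<noteq> h y" "h (n - 1) \<noteq> h n"
    using permutes_inj[OF H_permutes[OF h]] xy tau_points(3) by (auto dest: injD)
  ultimately show ?thesis unfolding good_def by (rule rel_cong[rotated 2])
qed

lemma sym_primitive_if_good:
  assumes "\<And>h. h \<in> H \<Longrightarrow> good h"
  shows "primitive_decomposition (sym_group n) (johnson_act n k) (johnson n k) \<P>"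
proof (rule sym_primitive_if_normalizes[of tau])
  show "tau permutes {1..n}" unfolding tau_def by (rule tr_permutes[OF tau_points(1,2)])
  show "\<not> evenperm tau" using tau_points by (simp add: tau_def evenperm_swap)
  show "tau \<circ> tau = id" by (simp add: tau_def)
  show "act tau e0 = e0" using tau_points act_tr_e0[of "n - 1" n] by (simp add: tau_def)
next
  fix h assume h: "h \<in> H"
  note ph = H_permutes[OF h]
  have "h (n - 1) \<noteq> h n"
    using permutes_inj[OF ph] tau_points(3) by (auto dest: injD)
  then have "tr (h (n - 1)) (h n) \<circ> tau \<in> H" using assms[OF h] by (auto simp: good_def rel_def)
  from H_inv[OF this] have "tau \<circ> tr (h (n - 1)) (h n) \<in> H" by (simp add: tau_def inv_tr_tr)
  \<comment> \<open>The conjugate \<open>tau \<circ> h \<circ> tau\<close> is this product followed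
    on the right by \<open>h\<close>.\<close>
  then have "tau \<circ> (h \<circ> tau \<circ> inv' h) \<in> H" by (simp add: tau_def conj_transpose[OF ph])
  from H_comp[OF this h] show "tau \<circ> h \<circ> tau \<in> H"
    using permutes_inv_o(2)[OF ph] by (simp add: comp_assoc)
qed

lemma H_in: "h \<in> H \<Longrightarrow> x \<in> {1..n} \<Longrightarrow> h x \<in> {1..n}"
  using permutes_in_image[OF H_permutes] by blast

lemma cell_cases: "cell x = 0 \<or> cell x = 1 \<or> cell x = 2"
  by (simp add: cell_def)

lemma cell_less: "cell x < 3"
  by (simp add: cell_def)

section \<open>Bad elements and the three cells\<close>

lemma bad_cells:
  assumes "h \<in> H" "\<not> good h" "x \<noteq> y" "rel x y" "x \<in> {1..n}" "y \<in> {1..n}"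
  shows "cell (h x) \<noteq> cell (h y)"
  using good_iff[OF assms(1,3,4)] assms cell_rel[OF H_in H_in] by blast

text \<open>If two cells were related, they would contain three related points, whose images under a
  bad element meet all three cells. Two of these images then lie in the cells of \<open>u\<close>
  and \<open>v\<close> and are related again, which would make the element good.\<close>

lemma rel_iff_cell:
  assumes bad: "h \<in> H" "\<not> good h" and uv: "u \<in> {1..n}" "v \<in> {1..n}"
  shows "rel u v \<longleftrightarrow> cell u = cell v"
proof
  assume r: "rel u v"
  show "cell u = cell v"
  proof (rule ccontr)
    assume ne: "cell u \<noteq> cell v"
    \<comment> \<open>Only the intersection cell can be a single point; of two different cells at
      least one is the symmetric difference or the outer cell, and either has a second
      point.\<close>
    have "\<exists>z \<in> {1..n}. z \<noteq> u \<and> z \<noteq> v \<and> (cell z = cell u \<or> cell z = cell v)"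
    proof (cases "cell u = 0 \<or> cell v = 0")
      case True
      then have "1 \<noteq> u \<and> 1 \<noteq> v \<or> k + 1 \<noteq> u \<and> k + 1 \<noteq> v" 
        using ne k2 by (auto simp: cell_def split: if_splits)
      moreover have "cell 1 = 0" "cell (k + 1) = 0" "1 \<in> {1..n}" "k + 1 \<in> {1..n}"
        using k3n by (auto simp: cell_def)
      ultimately show ?thesis using True by metis
    next
      case False
      then have "cell u = 2 \<or> cell v = 2" using ne cell_cases by metis
      moreover have "n - 1 \<noteq> u \<and> n - 1 \<noteq> v \<or> n \<noteq> u \<and> n \<noteq> v"
        using ne tau_points by metis
      ultimately show ?thesis using tau_points by metis
    qed
    then obtain z where z: "z \<in> {1..n}" "z \<noteq> u" "z \<noteq> v" "cell z = cell u \<or> cell z = cell v" by blast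
    have rz: "rel u z" "rel v z"
      using z cell_rel[OF uv(1) z(1)] cell_rel[OF uv(2) z(1)] r rel_sym rel_trans by metis+
    have "u \<noteq> v" using ne by blast
    have cells: "cell (h u) \<noteq> cell (h v)" "cell (h u) \<noteq> cell (h z)" "cell (h v) \<noteq> cell (h z)"
      using bad_cells[OF bad \<open>u \<noteq> v\<close> r uv] bad_cells[OF bad z(2)[symmetric] rz(1) uv(1) z(1)]
        bad_cells[OF bad z(3)[symmetric] rz(2) uv(2) z(1)] by simp_all
    have "\<exists>a \<in> {h u, h v, h z}. cell a = cell u" "\<exists>a \<in> {h u, h v, h z}. cell a = cell v"
      using three_values[OF cell_less cell_less cell_less cells cell_less] by blast+
    then obtain a b where ab: "a \<in> {u, v, z}" "b \<in> {u, v, z}" "cell (h a) = cell u" "cell (h b) = cell v"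
      by auto
    have abn: "a \<in> {1..n}" "b \<in> {1..n}" using ab uv z by auto
    have "a \<noteq> b" using ab ne by auto
    have "rel (h a) u" "rel v (h b)"
      using cell_rel[OF H_in[OF bad(1) abn(1)] uv(1)] cell_rel[OF uv(2) H_in[OF bad(1) abn(2)]] ab by auto
    then have "rel (h a) (h b)" using r rel_trans by blast
    moreover have "rel a b"
    proof -
      have "rel u u" "rel v v" "rel z z" by (auto simp: rel_def)
      moreover have "rel v u" "rel z u" "rel z v" using r rz rel_sym by blast+
      ultimately show ?thesis using ab(1,2) r rz by (elim insertE emptyE) simp_all
    qed
    ultimately show False using good_iff[OF bad(1) \<open>a \<noteq> b\<close>] bad(2) by blast
  qed
qed (rule cell_rel[OF uv])

text \<open>If \<open>h\<close> is bad, the images of three points of the last cell lie in different cells.  The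
  3-cycle on these images belongs to \<open>H\<close>, and moving its point in the last cell relates that cell to
  another one.\<close>

lemma good_if_large:
  assumes large: "k + 4 \<le> n" and h: "h \<in> H" shows "good h"
proof (rule ccontr)
  assume bad: "\<not> good h"
  have D: "n - 2 \<in> {1..n}" "cell (n - 2) = 2" "n - 2 \<noteq> n - 1" "n - 2 \<noteq> n"
    using large k2 by (auto simp: cell_def)
  have sep: "cell (h x) \<noteq> cell (h y)" if "x \<noteq> y" "x \<in> {1..n}" "y \<in> {1..n}" "cell x = 2" "cell y = 2" for x y
    using that bad_cells[OF h bad] cell_rel by simp
  have "cell (h (n - 2)) \<noteq> cell (h (n - 1))" "cell (h (n - 2)) \<noteq> cell (h n)" "cell (h (n - 1)) \<noteq> cell (h n)"
    using sep D tau_points by metis+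
  then have "cell (h (n - 2)) = 2 \<or> cell (h (n - 1)) = 2 \<or> cell (h n) = 2"
    using cell_cases[of "h (n - 2)"] cell_cases[of "h (n - 1)"] cell_cases[of "h n"] by auto
  then obtain z where z: "z \<in> {n - 2, n - 1, n}" "cell (h z) = 2" by auto
  then have "\<exists>x \<in> {n - 2, n - 1, n}. \<exists>y \<in> {n - 2, n - 1, n}. x \<noteq> y \<and> y \<noteq> z \<and> x \<noteq> z"
  proof -
    consider "z = n" | "z = n - 1" | "z = n - 2" using z(1) by blast
    then show ?thesis
    proof cases
      case 1
      then show ?thesis
        using D(3,4) tau_points(3) by (intro bexI[of _ "n - 2"] bexI[of _ "n - 1"]) auto
    next
      case 2
      then show ?thesis
        using D(3,4) tau_points(3) by (intro bexI[of _ "n - 2"] bexI[of _ "n"]) auto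
    next
      case 3
      then show ?thesis
        using D(3,4) tau_points(3) by (intro bexI[of _ "n - 1"] bexI[of _ "n"]) auto
    qed
  qed
  then obtain x y where xyz: "x \<in> {n - 2, n - 1, n}" "y \<in> {n - 2, n - 1, n}" "cell (h z) = 2"
    "x \<noteq> y" "y \<noteq> z" "x \<noteq> z" using z by blast
  have Dall: "w \<in> {1..n} \<and> cell w = 2" if "w \<in> {n - 2, n - 1, n}" for w
    using that D tau_points by blast
  have xyzn: "x \<in> {1..n}" "y \<in> {1..n}" "z \<in> {1..n}" "cell x = 2" "cell y = 2" "cell z = 2"
    using Dall[OF xyz(1)] Dall[OF xyz(2)] Dall[OF z(1)] by blast+
  define p q r where "p = h x" and "q = h y" and "r = h z"
  have pqr: "p \<in> {1..n}" "q \<in> {1..n}" "r \<in> {1..n}" "cell p \<noteq> 2" "cell q \<noteq> 2" "cell r = 2" "p \<noteq> q"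
  proof -
    show "p \<in> {1..n}" "q \<in> {1..n}" "r \<in> {1..n}"
      unfolding p_def q_def r_def using H_in[OF h] xyzn by blast+
    show "cell p \<noteq> 2" "cell q \<noteq> 2" "cell r = 2"
      unfolding p_def q_def r_def using sep[of x z] sep[of y z] xyzn xyz by simp_all
    show "p \<noteq> q"
      unfolding p_def q_def using permutes_inj[OF H_permutes[OF h]] xyz(4) by (simp add: inj_eq)
  qed
  have "\<exists>s \<in> {1..n}. \<exists>t \<in> {1..n}. cell s = 2 \<and> cell t = 2 \<and> s \<noteq> r \<and> t \<noteq> r \<and> s \<noteq> t"
    using D tau_points by metis
  then obtain s t where st: "s \<in> {1..n}" "t \<in> {1..n}" "cell s = 2" "cell t = 2" "s \<noteq> r" "t \<noteq> r" "s \<noteq> t" by blast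
  define g where "g = tr r s \<circ> tr s t"
  have g: "g \<in> H" unfolding g_def using cell_tr_tr pqr st by metis
  have gp: "g p = p" "g q = q" "g r = s"
    using pqr st by (auto simp: g_def Transposition.transpose_def)
  have "tr x y \<circ> tr y z \<in> H" using cell_tr_tr xyz xyzn by metis
  from H_conj_tr[OF h this] have c: "tr p q \<circ> tr q r \<in> H" by (simp add: p_def q_def r_def)
  from H_conj_tr[OF g this] have "tr p q \<circ> tr q s \<in> H" by (simp add: gp)
  moreover have "tr q r \<circ> tr p q \<in> H" using H_inv[OF c] by (simp add: inv_tr_tr)
  ultimately have "(tr q r \<circ> tr p q) \<circ> (tr p q \<circ> tr q s) \<in> H" using H_comp by blast
  \<comment> \<open>Rotating this 3-cycle shows \<open>tr r s\<close>, within the last cell, to be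
    congruent to \<open>tr r q\<close>, which leaves it.\<close>
  then have "tr r q \<circ> tr q s \<in> H" by (simp add: tr_tr_cancel transpose_commute)
  then have "tr r s \<circ> tr r q \<in> H" using tr_tr_rotate[of r q s] pqr st by metis
  then have "rel r s \<longleftrightarrow> rel r q" using rel_cong[of r s r q] pqr st by metis
  moreover have "rel r s" using cell_rel pqr st by metis
  ultimately show False
    using rel_iff_cell[OF h bad] pqr by metis
qed

text \<open>A bad element makes relatedness coincide with the cells, so each element of
  \<open>H\<close> either keeps every pair within a cell together or separates every such pair; one
  pair decides.\<close>

lemma cell_dichotomy:
  assumes bad: "h \<in> H" "\<not> good h" and g: "g \<in> H"
    and xy: "x \<in> {1..n}" "y \<in> {1..n}" "x \<noteq> y" "cell x = cell y"
  shows "cell (g x) = cell (g y) \<longleftrightarrow> good g"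
  using good_iff[OF g xy(3) cell_rel[OF xy(1,2,4)]] rel_iff_cell[OF bad H_in[OF g xy(1)] H_in[OF g xy(2)]]
  by simp

end

section \<open>Conjugates of the cell involution\<close>

text \<open>Conjugation without inverses. For bijective \<open>p\<close> this says only that the
  conjugate of \<open>T\<close> by \<open>p\<close> is contained in \<open>T\<close>.\<close>

definition permutes_by_conj :: "('a \<Rightarrow> 'a) set \<Rightarrow> ('a \<Rightarrow> 'a) \<Rightarrow> bool" where
  "permutes_by_conj T p \<longleftrightarrow> (\<forall>r \<in> T. \<exists>r' \<in> T. p \<circ> r = r' \<circ> p)"

lemma permutes_by_conj_comp:
  assumes "permutes_by_conj T p" "permutes_by_conj T q"
  shows "permutes_by_conj T (p \<circ> q)"
  using assms unfolding permutes_by_conj_def by (metis comp_assoc)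

text \<open>This exhausts the conjugates: if conjugates agreeing on a moved point coincide, a
  covering family of conjugates leaves room for no other.\<close>

definition pairs_covered :: "nat \<Rightarrow> (nat \<Rightarrow> nat) set \<Rightarrow> bool" where
  "pairs_covered n T \<longleftrightarrow> (\<forall>x \<in> {1..n}. \<forall>y \<in> {1..n}. x \<noteq> y \<longrightarrow> (\<exists>r \<in> T. r x = y))"

context alt_primitive
begin

lemma alt_subgroupI:
  assumes "K \<subseteq> carrier (alt_group n)" "id \<in> K" "\<And>p q. p \<in> K \<Longrightarrow> q \<in> K \<Longrightarrow> p \<circ> q \<in> K"
    "\<And>p. p \<in> K \<Longrightarrow> inv' p \<in> K"
  shows "subgroup K (alt_group n)"
  using assms by (intro subgroup.intro) (auto simp: alt_group_mult alt_group_one alt_group_inv_equality subset_eq)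

text \<open>As \<open>s\<close> fixes \<open>e0\<close>, the orbit of \<open>e0\<close> under
  \<open>s H s\<close> is \<open>s P0\<close>. Since \<open>s\<close> normalizes the alternating
  group, even when \<open>s\<close> is odd, the translates of \<open>s P0\<close> are the images of
  the parts under \<open>s\<close>.\<close>

lemma isomorphic_if_conjugate:
  assumes s: "s permutes {1..n}" "s \<circ> s = id" "act s e0 = e0"
    and H: "(\<lambda>h. s \<circ> h \<circ> s) ` H = carrier G"
    and Q: "Q = orbit G (edge_act (johnson_act n k)) e0"
  shows "isomorphic_decompositions (johnson n k) \<P> (orbit (alt_group n) (part_act (johnson_act n k)) Q)"
proof -
  have G_perm: "g permutes {1..n}" if "g \<in> carrier G" for g
  proof -
    obtain h where "h \<in> H" "g = s \<circ> h \<circ> s" using \<open>g \<in> carrier G\<close> unfolding H[symmetric] by blast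
    then show ?thesis using s(1) H_permutes by (simp add: permutes_compose)
  qed
  have Q1: "Q = (\<lambda>g. act g e0) ` carrier G"
    unfolding Q orbit_def using edge_act_johnson[OF e0_edge] by auto
  also have "\<dots> = (\<lambda>h. act s (act h e0)) ` H"
    unfolding H[symmetric] image_image act_comp s(3) ..
  also have "\<dots> = act s ` P0" by (simp add: P0_eq image_image)
  finally have Q2: "Q = act s ` P0" .
  have Qe: "Q \<subseteq> edges (johnson n k)"
    unfolding Q1 using act_edges[OF G_perm e0_edge] by blast
  have ss: "act s ` act s ` P = P" for P
    by (metis act_image_comp act_image_id s(2))
  have conj: "s \<circ> p \<circ> s \<in> carrier (alt_group n)" if "p \<in> carrier (alt_group n)" for p
  proof -
    have p: "p permutes {1..n}" "evenperm p" using that by (auto simp: alt_group_carrier)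
    then have "permutation s" "permutation p" using s(1) permutation_permutes by blast+
    then show ?thesis
      using p s(1) by (simp add: alt_group_carrier permutes_compose evenperm_comp permutation_compose)
  qed
  have scs: "s \<circ> (s \<circ> p \<circ> s) \<circ> s = p" for p
    using s(2) by (metis comp_assoc comp_id id_comp)
  have "orbit (alt_group n) (part_act (johnson_act n k)) Q = (\<lambda>p. act p ` Q) ` carrier (alt_group n)"
    unfolding orbit_def using part_act_johnson[OF Qe] by auto
  also have "\<dots> = (\<lambda>p. act (s \<circ> p \<circ> s) ` Q) ` carrier (alt_group n)"
  proof
    show "(\<lambda>p. act p ` Q) ` carrier (alt_group n) \<subseteq> (\<lambda>p. act (s \<circ> p \<circ> s) ` Q) ` carrier (alt_group n)"
    proof (rule image_subsetI)
      fix p assume "p \<in> carrier (alt_group n)"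
      then show "act p ` Q \<in> (\<lambda>p. act (s \<circ> p \<circ> s) ` Q) ` carrier (alt_group n)"
        by (intro image_eqI[of _ _ "s \<circ> p \<circ> s"]) (simp_all only: scs conj)
    qed
    show "(\<lambda>p. act (s \<circ> p \<circ> s) ` Q) ` carrier (alt_group n) \<subseteq> (\<lambda>p. act p ` Q) ` carrier (alt_group n)"
      using conj by blast
  qed
  also have "\<dots> = (\<lambda>P. act s ` P) ` (\<lambda>p. act p ` P0) ` carrier (alt_group n)"
    unfolding image_image[of "\<lambda>P. act s ` P"] act_image_comp Q2 ss ..
  also have "\<dots> = (\<lambda>P. act s ` P) ` \<P>" using parts_eq by simp
  finally have orb: "orbit (alt_group n) (part_act (johnson_act n k)) Q = (\<lambda>P. act s ` P) ` \<P>" .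
  have "(\<lambda>P. (\<lambda>e. johnson_act n k s ` e) ` P) ` \<P> = (\<lambda>P. act s ` P) ` \<P>"
  proof (rule image_cong[OF refl])
    fix P assume "P \<in> \<P>"
    then show "(\<lambda>e. johnson_act n k s ` e) ` P = act s ` P"
      using part_act_johnson[OF part_edges, of P s] by (simp add: part_act_def edge_act_def)
  qed
  then show ?thesis
    unfolding isomorphic_decompositions_def orb using johnson_act_aut[OF s(1)] by blast
qed

text \<open>The conjugate \<open>K\<close> of \<open>M\<close> by \<open>s\<close> is a proper
  subgroup of the alternating group that contains \<open>H\<close>, so maximality of
  \<open>H\<close> applies to it.\<close>

lemma conj_H_eq:
  assumes s: "s permutes {1..n}" "s \<circ> s = id"
    and M: "subgroup M (alt_group n)" "M \<noteq> carrier (alt_group n)"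
    and HM: "\<And>h. h \<in> H \<Longrightarrow> s \<circ> h \<circ> s \<in> M"
  shows "(\<lambda>h. s \<circ> h \<circ> s) ` H = M"
proof -
  have Ma: "M \<subseteq> carrier (alt_group n)" using M(1) by (rule subgroup.subset)
  have Mc: "p \<circ> q \<in> M" if "p \<in> M" "q \<in> M" for p q
    using subgroup.m_closed[OF M(1) that] by (simp add: alt_group_mult)
  have Mi: "inv' p \<in> M" if "p \<in> M" for p
    using subgroup.m_inv_closed[OF M(1) that] Ma that by (metis alt_group_inv_equality subsetD)
  have Mid: "id \<in> M" using subgroup.one_closed[OF M(1)] by (simp add: alt_group_one)
  have scs: "s \<circ> (s \<circ> p \<circ> s) \<circ> s = p" for p
    using s(2) by (metis comp_assoc comp_id id_comp)
  have conj: "s \<circ> p \<circ> s \<in> carrier (alt_group n)" if "p \<in> carrier (alt_group n)" for p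
  proof -
    have p: "p permutes {1..n}" "evenperm p" using that by (auto simp: alt_group_carrier)
    then have "permutation s" "permutation p" using s(1) permutation_permutes by blast+
    then show ?thesis
      using p s(1) by (simp add: alt_group_carrier permutes_compose evenperm_comp permutation_compose)
  qed
  have si: "inv' s = s" using s(2) by (simp add: inv_unique_comp)
  define K where "K = {p. s \<circ> p \<circ> s \<in> M}"
  have Ka: "K \<subseteq> carrier (alt_group n)"
  proof
    fix p assume "p \<in> K"
    then have "s \<circ> p \<circ> s \<in> carrier (alt_group n)" using Ma by (auto simp: K_def)
    from conj[OF this] show "p \<in> carrier (alt_group n)" by (simp only: scs)
  qed
  have "subgroup K (alt_group n)"
  proof (rule alt_subgroupI[OF Ka])
    show "id \<in> K" using Mid s(2) by (simp add: K_def)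
  next
    fix p q assume "p \<in> K" "q \<in> K"
    then have "(s \<circ> p \<circ> s) \<circ> (s \<circ> q \<circ> s) \<in> M" using Mc by (simp add: K_def)
    moreover have "(s \<circ> p \<circ> s) \<circ> (s \<circ> q \<circ> s) = s \<circ> (p \<circ> q) \<circ> s"
      using s(2) by (metis comp_assoc comp_id)
    ultimately show "p \<circ> q \<in> K" by (simp add: K_def)
  next
    fix p assume p: "p \<in> K"
    then have "p permutes {1..n}" using Ka alt_group_carrier by blast
    then have "bij p" by (rule permutes_bij)
    moreover have "bij s" using s(1) permutes_bij by blast
    ultimately have "inv' (s \<circ> p \<circ> s) = s \<circ> inv' p \<circ> s"
      by (simp add: o_inv_distrib bij_comp si comp_assoc)
    then show "inv' p \<in> K" using p Mi unfolding K_def by fastforce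
  qed
  moreover have "H \<subseteq> K" using HM by (auto simp: K_def)
  ultimately have "K = H \<or> K = carrier (alt_group n)" by (rule H_maximal)
  moreover have "K \<noteq> carrier (alt_group n)"
  proof
    assume full: "K = carrier (alt_group n)"
    have "s \<circ> (s \<circ> p \<circ> s) \<circ> s \<in> M" if "p \<in> carrier (alt_group n)" for p
      using conj[OF that] unfolding full[symmetric] K_def by blast
    then show False using M(2) Ma by (auto simp: scs)
  qed
  ultimately have KH: "K = H" by blast
  show ?thesis
  proof
    show "(\<lambda>h. s \<circ> h \<circ> s) ` H \<subseteq> M" using HM by blast
    show "M \<subseteq> (\<lambda>h. s \<circ> h \<circ> s) ` H"
    proof
      fix p assume "p \<in> M"
      then have "s \<circ> p \<circ> s \<in> H" unfolding KH[symmetric] K_def by (simp only: scs mem_Collect_eq)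
      then show "p \<in> (\<lambda>h. s \<circ> h \<circ> s) ` H" by (intro image_eqI[of _ _ "s \<circ> p \<circ> s"]) (simp_all only: scs)
    qed
  qed
qed

end

text \<open>The assumption on \<open>s0\<close> forces the cells to have at most two points.\<close>

locale alt_primitive_bad = alt_primitive5 +
  fixes s0 bad :: "nat \<Rightarrow> nat"
  assumes bad: "bad \<in> H" "\<not> good bad"
    and s0_permutes: "s0 permutes {1..n}" and s0_invol: "s0 \<circ> s0 = id"
    and s0_cell: "\<And>x y. x \<in> {1..n} \<Longrightarrow> y \<in> {1..n} \<Longrightarrow> x \<noteq> y \<Longrightarrow> cell x = cell y \<longleftrightarrow> y = s0 x"
begin

text \<open>As \<open>g\<close> is bijective, the equation determines \<open>m\<close> as the
  conjugate of \<open>s0\<close> by \<open>g\<close>.\<close>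

definition s0_conjugates :: "(nat \<Rightarrow> nat) set" where
  "s0_conjugates = {m. \<exists>g \<in> H. g \<circ> s0 = m \<circ> g}"

lemma s0_conjugates_s0: "s0 \<in> s0_conjugates"
  unfolding s0_conjugates_def using H_id by (intro CollectI bexI[of _ id]) simp_all

lemma s0_conjugates_eqI:
  assumes "g \<in> H" "m \<in> s0_conjugates" "g \<circ> m = m' \<circ> g" shows "m' \<in> s0_conjugates"
proof -
  obtain h where h: "h \<in> H" "h \<circ> s0 = m \<circ> h" using assms(2) by (auto simp: s0_conjugates_def)
  then have "(g \<circ> h) \<circ> s0 = m' \<circ> (g \<circ> h)" using assms(3) by (metis comp_assoc)
  then show ?thesis using H_comp[OF assms(1) h(1)] by (auto simp: s0_conjugates_def)
qed

lemma s0_conjugates_conj: 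
  assumes "g \<in> H" "m \<in> s0_conjugates" shows "\<exists>m' \<in> s0_conjugates. g \<circ> m = m' \<circ> g"
proof -
  have "g \<circ> m = (g \<circ> m \<circ> inv' g) \<circ> g"
    using permutes_inv_o(2)[OF H_permutes[OF assms(1)]] by (simp add: comp_assoc)
  then show ?thesis using s0_conjugates_eqI[OF assms] by blast
qed

lemma s0_conjugates_form:
  assumes "m \<in> s0_conjugates" obtains g where "g \<in> H" "m = g \<circ> s0 \<circ> inv' g"
proof -
  obtain g where g: "g \<in> H" "g \<circ> s0 = m \<circ> g" using assms by (auto simp: s0_conjugates_def)
  then have "m = g \<circ> s0 \<circ> inv' g"
    using permutes_inv_o(1)[OF H_permutes[OF g(1)]] by (simp add: comp_assoc)
  then show thesis using that g by blast
qed

lemma s0_conjugates_permutes: "m \<in> s0_conjugates \<Longrightarrow> m permutes {1..n}"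
  using s0_conjugates_form H_permutes s0_permutes permutes_compose permutes_inv by metis

lemma s0_conjugates_invol: assumes "m \<in> s0_conjugates" shows "m (m x) = x"
proof -
  obtain g where g: "g \<in> H" "m = g \<circ> s0 \<circ> inv' g" using assms s0_conjugates_form by blast
  have "s0 (s0 y) = y" for y using s0_invol by (metis comp_apply id_apply)
  then show ?thesis using g(2) permutes_inverses[OF H_permutes[OF g(1)]] by simp
qed

lemma s0_moves: "\<exists>x \<in> {1..n}. s0 x \<noteq> x"
  using s0_cell[of "n - 1" n] tau_points by metis

lemma s0_conjugates_ne_id: assumes "m \<in> s0_conjugates" shows "m \<noteq> id"
proof
  assume m: "m = id"
  obtain g where g: "g \<in> H" "g \<circ> s0 = m \<circ> g" using assms by (auto simp: s0_conjugates_def)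
  then have "g (s0 x) = g x" for x using m by (metis comp_apply id_apply)
  then have "s0 x = x" for x using permutes_inj[OF H_permutes[OF g(1)]] by (meson injD)
  then show False using s0_moves by blast
qed

text \<open>Let \<open>m\<close> be the conjugate of \<open>s0\<close> by \<open>g\<close>.
  Agreement at a moved point means that \<open>g\<close> keeps one two-point cell together, so
  \<open>g\<close> is good by the dichotomy and keeps all of them together. Then \<open>g\<close>
  commutes with \<open>s0\<close>.\<close>

lemma s0_conjugates_meets_s0:
  assumes m: "m \<in> s0_conjugates" and y: "m y = s0 y" "s0 y \<noteq> y" shows "m = s0"
proof -
  obtain g where g: "g \<in> H" "g \<circ> s0 = m \<circ> g" using m by (auto simp: s0_conjugates_def)
  note pg = H_permutes[OF g(1)]
  have gs: "g (s0 x) = m (g x)" for x using g(2) by (metis comp_apply)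
  have ginj: "g a = g b \<longleftrightarrow> a = b" for a b using permutes_inj[OF pg] by (auto dest: injD)
  have s0s0: "s0 (s0 x) = x" for x using s0_invol by (metis comp_apply id_apply)
  have sin: "s0 x \<in> {1..n}" if "x \<in> {1..n}" for x using permutes_in_image[OF s0_permutes] that by blast
  have s0out: "s0 x = x" if "x \<notin> {1..n}" for x using permutes_not_in[OF s0_permutes that] .
  have yn: "y \<in> {1..n}" using y s0out by metis
  obtain w where w: "y = g w" "w \<in> {1..n}"
    using yn permutes_surj[OF pg] permutes_in_image[OF pg] by (metis surjD)
  have gsw: "g (s0 w) = s0 (g w)" using gs w y by simp
  have sw: "s0 w \<noteq> w" using gsw w y ginj by metis
  have cells: "cell (s0 x) = cell x" if "x \<in> {1..n}" for x
    using s0_cell[OF that sin[OF that]] by (cases "s0 x = x") auto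
  have "cell (g (s0 w)) = cell (g w)" unfolding gsw using cells w yn by simp
  then have good: "good g" 
    using cell_dichotomy[OF bad g(1) w(2) sin[OF w(2)] sw[symmetric]] cells[OF w(2)] by simp
  have comm: "g (s0 x) = s0 (g x)" if x: "x \<in> {1..n}" "s0 x \<noteq> x" for x
  proof -
    have "cell (g x) = cell (g (s0 x))"
      using cell_dichotomy[OF bad g(1) x(1) sin[OF x(1)] x(2)[symmetric]] good cells[OF x(1)] by simp
    moreover have "g x \<noteq> g (s0 x)" using x(2) ginj by metis
    ultimately show ?thesis using s0_cell[OF H_in[OF g(1) x(1)] H_in[OF g(1) sin[OF x(1)]]] by blast
  qed
  \<comment> \<open>There remain the points fixed by \<open>s0\<close>. Should \<open>g x\<close>
    have a partner \<open>g u\<close> in its cell, then \<open>u\<close> moved by \<open>s0\<close>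
    contradicts \<open>comm\<close>, and \<open>u\<close> fixed contradicts goodness of the inverse
    of \<open>g\<close>, which would relate the different cells of \<open>u\<close> and
    \<open>x\<close>.\<close>
  have comm': "g (s0 x) = s0 (g x)" if x: "x \<in> {1..n}" for x
  proof (cases "s0 x = x")
    case True
    have "s0 (g x) = g x"
    proof (rule ccontr)
      assume ne: "s0 (g x) \<noteq> g x"
      have "s0 (g x) \<in> {1..n}" using sin H_in[OF g(1) x] by blast
      then obtain u where u: "s0 (g x) = g u" "u \<in> {1..n}"
        using permutes_surj[OF pg] permutes_in_image[OF pg] by (metis surjD)
      have "cell (g u) = cell (g x)" unfolding u(1)[symmetric] using cells H_in[OF g(1) x] by blast
      have ux: "u \<noteq> x" using ne u by metis
      show False
      proof (cases "s0 u = u")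
        case False
        then have "g (s0 u) = g x" using comm[OF u(2)] u(1) s0s0 by metis
        then have "s0 u = x" by (simp add: ginj)
        then show False using True s0s0 ux by metis
      next
        case True
        have nu: "g (n - 1) \<noteq> g n" using ginj tau_points by blast
        have "cell u \<noteq> cell x" using s0_cell[OF u(2) x ux] True ux by metis
        moreover have "rel u x \<longleftrightarrow> cell u = cell x" using rel_iff_cell[OF bad u(2) x] .
        moreover have "rel (g u) (g x)" using cell_rel[OF H_in[OF g(1) u(2)] H_in[OF g(1) x]]
          \<open>cell (g u) = cell (g x)\<close> by blast
        moreover have "rel (inv' g (g u)) (inv' g (g x)) \<longleftrightarrow> good (inv' g)"
          using good_iff[OF H_inv[OF g(1)], of "g u" "g x"] \<open>rel (g u) (g x)\<close> ginj ux by blast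
        moreover have "good (inv' g)"
        proof -
          have r: "rel (g (n - 1)) (g n)" using good by (simp add: good_def)
          have "rel (n - 1) n" using cell_rel[OF tau_points(1,2)] tau_points(4,5) by simp
          then show ?thesis using good_iff[OF H_inv[OF g(1)] nu r] by (simp add: permutes_inverses[OF pg])
        qed
        ultimately show False by (simp add: permutes_inverses[OF pg])
      qed
    qed
    then show ?thesis using True by simp
  qed (use comm x in blast)
  have "m (g x) = s0 (g x)" for x
    using comm'[of x] gs[of x] s0out[of x] permutes_not_in[OF pg, of x] by (cases "x \<in> {1..n}") auto
  then show ?thesis using permutes_surj[OF pg] by (metis ext surjD)
qed

lemma s0_conjugates_meets:
  assumes m: "m \<in> s0_conjugates" "m' \<in> s0_conjugates" "m x = m' x" "m x \<noteq> x" shows "m = m'"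
proof -
  obtain g where g: "g \<in> H" "m' = g \<circ> s0 \<circ> inv' g" using m(2) s0_conjugates_form by blast
  note pg = H_permutes[OF g(1)]
  have "inv' g \<circ> m = (inv' g \<circ> m \<circ> g) \<circ> inv' g"
    using permutes_inv_o(1)[OF pg] by (simp add: comp_assoc)
  from s0_conjugates_eqI[OF H_inv[OF g(1)] m(1) this] have "inv' g \<circ> m \<circ> g \<in> s0_conjugates" .
  moreover have "(inv' g \<circ> m \<circ> g) (inv' g x) = s0 (inv' g x)"
    using m(3) by (simp add: g(2) permutes_inverses[OF pg])
  moreover have "s0 (inv' g x) \<noteq> inv' g x"
    using m(3,4) by (metis comp_apply g(2) permutes_inverses(1)[OF pg])
  ultimately have "inv' g \<circ> m \<circ> g = s0" by (rule s0_conjugates_meets_s0)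
  then have "m' = (g \<circ> inv' g) \<circ> m \<circ> (g \<circ> inv' g)" unfolding g(2) by (metis comp_assoc)
  then show ?thesis by (simp add: permutes_inv_o[OF pg])
qed

text \<open>Conjugating a member of \<open>s T s\<close> by \<open>g\<close> gives some conjugate
  \<open>m\<close> of \<open>s0\<close>. A point \<open>z\<close> moved by \<open>m\<close> selects
  an \<open>r'\<close> in \<open>T\<close> whose conjugate by \<open>s\<close> agrees with
  \<open>m\<close> at \<open>z\<close>, hence everywhere.\<close>

lemma H_permutes_by_conj:
  assumes s: "s permutes {1..n}" "s \<circ> s = id"
    and T: "\<And>r. r \<in> T \<Longrightarrow> s \<circ> r \<circ> s \<in> s0_conjugates" and cover: "pairs_covered n T" and g: "g \<in> H"
  shows "permutes_by_conj T (s \<circ> g \<circ> s)"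
  unfolding permutes_by_conj_def
proof
  fix r assume "r \<in> T"
  then obtain m where m: "m \<in> s0_conjugates" "g \<circ> (s \<circ> r \<circ> s) = m \<circ> g" using s0_conjugates_conj[OF g T] by blast
  have ss: "s (s x) = x" for x using s(2) by (metis comp_apply id_apply)
  obtain z where z: "m z \<noteq> z" using s0_conjugates_ne_id[OF m(1)] by (metis eq_id_iff)
  then have "z \<in> {1..n}" using permutes_not_in[OF s0_conjugates_permutes[OF m(1)]] by metis
  then have "s z \<in> {1..n}" "s (m z) \<in> {1..n}"
    using permutes_in_image[OF s0_conjugates_permutes[OF m(1)]] permutes_in_image[OF s(1)] by blast+
  moreover have "s z \<noteq> s (m z)" using z ss by metis
  ultimately obtain r' where r': "r' \<in> T" "r' (s z) = s (m z)" using cover unfolding pairs_covered_def by blast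
  have "m z = (s \<circ> r' \<circ> s) z" using r' ss by simp
  then have eq: "m = s \<circ> r' \<circ> s" using s0_conjugates_meets[OF m(1) T[OF r'(1)]] z by blast
  have "(s \<circ> g \<circ> s) \<circ> r = r' \<circ> (s \<circ> g \<circ> s)"
  proof
    fix x
    have "g (s (r (s (s x)))) = s (r' (s (g (s x))))"
      using m(2) unfolding eq by (metis comp_apply)
    then show "((s \<circ> g \<circ> s) \<circ> r) x = (r' \<circ> (s \<circ> g \<circ> s)) x" by (simp add: ss)
  qed
  then show "\<exists>r' \<in> T. s \<circ> g \<circ> s \<circ> r = r' \<circ> (s \<circ> g \<circ> s)" using r' by blast
qed

text \<open>The third assumption on \<open>G\<close> places the stabilizer of \<open>T\<close> in
  the alternating group inside \<open>G\<close>. So \<open>s H s\<close> lies in the proper subgroup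
  \<open>G\<close>, and maximality turns inclusion into equality.\<close>

lemma isomorphic_if_cover:
  assumes s: "s permutes {1..n}" "s \<circ> s = id" "act s e0 = e0"
    and T: "\<And>r. r \<in> T \<Longrightarrow> s \<circ> r \<circ> s \<in> s0_conjugates" and cover: "pairs_covered n T"
    and G: "subgroup (carrier G) (alt_group n)" "carrier G \<noteq> carrier (alt_group n)"
      "\<And>p. p \<in> carrier (alt_group n) \<Longrightarrow> permutes_by_conj T p \<Longrightarrow> p \<in> carrier G"
    and Q: "Q = orbit G (edge_act (johnson_act n k)) e0"
  shows "isomorphic_decompositions (johnson n k) \<P> (orbit (alt_group n) (part_act (johnson_act n k)) Q)"
proof (rule isomorphic_if_conjugate[OF s _ Q], rule conj_H_eq[OF s(1,2) G(1,2)])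
  fix h assume h: "h \<in> H"
  have p: "h permutes {1..n}" "evenperm h" using H_alt[OF h] by (auto simp: alt_group_carrier)
  then have "permutation s" "permutation h" using s(1) permutation_permutes by blast+
  then have "s \<circ> h \<circ> s \<in> carrier (alt_group n)"
    using p s(1) by (simp add: alt_group_carrier permutes_compose evenperm_comp permutation_compose)
  then show "s \<circ> h \<circ> s \<in> carrier G" using G(3) H_permutes_by_conj[OF s(1,2) T cover h] by blast
qed

end

section \<open>The two exceptional groups\<close>

declare One_nat_def [simp del]

lemma perm_eqI5:
  fixes p q :: "nat \<Rightarrow> nat"
  assumes "p permutes {1..5}" "q permutes {1..5}"
    "p 1 = q 1" "p 2 = q 2" "p 3 = q 3" "p 4 = q 4" "p 5 = q 5"
  shows "p = q"
proof
  fix x :: nat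
  consider "x \<notin> {1..5}" | "x = 1" | "x = 2" | "x = 3" | "x = 4" | "x = 5" by fastforce
  then show "p x = q x"
    by cases (simp_all add: assms(3-) permutes_not_in[OF assms(1)] permutes_not_in[OF assms(2)] del: atLeastAtMost_iff)
qed

lemma perm_eqI6:
  fixes p q :: "nat \<Rightarrow> nat"
  assumes "p permutes {1..6}" "q permutes {1..6}"
    "p 1 = q 1" "p 2 = q 2" "p 3 = q 3" "p 4 = q 4" "p 5 = q 5" "p 6 = q 6"
  shows "p = q"
proof
  fix x :: nat
  consider "x \<notin> {1..6}" | "x = 1" | "x = 2" | "x = 3" | "x = 4" | "x = 5" | "x = 6" by fastforce
  then show "p x = q x"
    by cases (simp_all add: assms(3-) permutes_not_in[OF assms(1)] permutes_not_in[OF assms(2)] del: atLeastAtMost_iff)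
qed

lemma subgroup_generated_alt:
  assumes "S \<subseteq> carrier (alt_group n)"
  shows "subgroup (carrier (subgroup_generated (sym_group n) S)) (alt_group n)"
proof -
  interpret group "sym_group n" by (rule sym_group_is_group)
  have "subgroup (carrier (subgroup_generated (sym_group n) S)) (sym_group n)"
    by (rule subgroup_subgroup_generated)
  moreover have "carrier (subgroup_generated (sym_group n) S) \<subseteq> carrier (alt_group n)"
    by (rule subgroup_generated_minimal[OF alt_group_is_subgroup assms])
  ultimately show ?thesis
    unfolding alt_group_def using subgroup_incl[OF _ alt_group_is_subgroup] by (simp add: alt_group_def)
qed

text \<open>Inverses of generators are assumed separately because \<open>permutes_by_conj\<close>
  asserts an inclusion, which for general \<open>T\<close> does not pass to inverses.\<close>

lemma permutes_by_conj_generated: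
  assumes S: "S \<subseteq> carrier (sym_group n)"
    and gen: "\<And>s. s \<in> S \<Longrightarrow> permutes_by_conj T s" "\<And>s. s \<in> S \<Longrightarrow> permutes_by_conj T (inv' s)"
    and p: "p \<in> carrier (subgroup_generated (sym_group n) S)"
  shows "permutes_by_conj T p"
proof -
  have "p \<in> generate (sym_group n) S"
    using p S by (simp add: carrier_subgroup_generated Int_absorb1)
  then show ?thesis
  proof induction
    case one
    then show ?case unfolding sym_group_one permutes_by_conj_def by (metis comp_id id_comp)
  next
    case (incl h)
    then show ?case by (rule gen)
  next
    case (inv h)
    then show ?case using gen(2) S by (metis subsetD sym_group_inv_equality)
  next
    case (eng h1 h2)
    then show ?case unfolding sym_group_mult by (intro permutes_by_conj_comp)
  qed
qed

lemma generated_closed: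
  assumes "p \<in> carrier (subgroup_generated (sym_group n) S)" "q \<in> carrier (subgroup_generated (sym_group n) S)"
  shows "p \<circ> q \<in> carrier (subgroup_generated (sym_group n) S)"
  using assms by (simp add: carrier_subgroup_generated generate.eng flip: sym_group_mult[of n])

lemma generated_cancel:
  assumes w: "w \<in> carrier (subgroup_generated (sym_group n) S)"
    and "w \<circ> p \<in> carrier (subgroup_generated (sym_group n) S)"
  shows "p \<in> carrier (subgroup_generated (sym_group n) S)"
proof -
  interpret group "sym_group n" by (rule sym_group_is_group)
  have sub: "subgroup (carrier (subgroup_generated (sym_group n) S)) (sym_group n)"
    by (rule subgroup_subgroup_generated)
  have ws: "w \<in> carrier (sym_group n)" using subgroup.subset[OF sub] w by blast
  then have "inv' w \<in> carrier (subgroup_generated (sym_group n) S)"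
    using subgroup.m_inv_closed[OF sub w] by simp
  from generated_closed[OF this assms(2)] show ?thesis
    using permutes_inv_o(2)[of w "{1..n}"] ws by (simp add: sym_group_carrier comp_assoc[symmetric])
qed

section \<open>The dihedral group of the pentagon\<close>

definition a5 :: "nat \<Rightarrow> nat" where "a5 = tr 1 2 \<circ> tr 2 3 \<circ> tr 3 4 \<circ> tr 4 5"
definition b5 :: "nat \<Rightarrow> nat" where "b5 = tr 1 3 \<circ> tr 4 5"

text \<open>The reflections of the pentagon \<open>1, 2, 3, 4, 5\<close>.\<close>

definition T5 :: "(nat \<Rightarrow> nat) set" where
  "T5 = {tr 2 5 \<circ> tr 3 4, b5, tr 1 5 \<circ> tr 2 4, tr 1 2 \<circ> tr 3 5, tr 1 4 \<circ> tr 2 3}"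

lemmas perm_intros = permutes_compose permutes_swap_id permutes_id

lemma perm5: "a5 permutes {1..5}" "b5 permutes {1..5}" "r \<in> T5 \<Longrightarrow> r permutes {1..5}"
  by (auto simp: a5_def b5_def T5_def intro!: perm_intros)

lemma even5: "evenperm a5" "evenperm b5"
  by (simp_all add: a5_def b5_def evenperm_comp evenperm_swap permutation_compose permutation_swap_id)

lemma H1_eq: "H\<^sub>1 = subgroup_generated (sym_group 5) {a5, b5}"
  by (simp add: H\<^sub>1_def a5_def b5_def comp_assoc)

lemma H1_subgroup: "subgroup (carrier H\<^sub>1) (alt_group 5)"
  unfolding H1_eq by (rule subgroup_generated_alt) (simp add: alt_group_carrier perm5 even5)

lemma H1_mem: "a5 \<in> carrier H\<^sub>1" "b5 \<in> carrier H\<^sub>1" "id \<in> carrier H\<^sub>1"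
  "p \<in> carrier H\<^sub>1 \<Longrightarrow> q \<in> carrier H\<^sub>1 \<Longrightarrow> p \<circ> q \<in> carrier H\<^sub>1"
proof -
  show "p \<circ> q \<in> carrier H\<^sub>1" if "p \<in> carrier H\<^sub>1" "q \<in> carrier H\<^sub>1" for p q
    using that unfolding H1_eq by (rule generated_closed)
  show "a5 \<in> carrier H\<^sub>1" "b5 \<in> carrier H\<^sub>1"
    by (auto simp: H1_eq carrier_subgroup_generated sym_group_carrier perm5 intro!: generate.incl)
  show "id \<in> carrier H\<^sub>1"
    using generate.one[of "sym_group 5"] by (simp add: H1_eq carrier_subgroup_generated sym_group_one)
qed

lemma a5_conj:
  "a5 \<circ> b5 = (tr 1 5 \<circ> tr 2 4) \<circ> a5" "a5 \<circ> (tr 1 5 \<circ> tr 2 4) = (tr 1 2 \<circ> tr 3 5) \<circ> a5"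
  "a5 \<circ> (tr 1 2 \<circ> tr 3 5) = (tr 1 4 \<circ> tr 2 3) \<circ> a5" "a5 \<circ> (tr 1 4 \<circ> tr 2 3) = (tr 2 5 \<circ> tr 3 4) \<circ> a5"
  "a5 \<circ> (tr 2 5 \<circ> tr 3 4) = b5 \<circ> a5"
  by (rule perm_eqI5; auto simp: a5_def b5_def intro!: perm_intros; fail)+

lemma b5_conj:
  "b5 \<circ> b5 = b5 \<circ> b5" "b5 \<circ> (tr 1 5 \<circ> tr 2 4) = (tr 2 5 \<circ> tr 3 4) \<circ> b5"
  "b5 \<circ> (tr 1 2 \<circ> tr 3 5) = (tr 1 4 \<circ> tr 2 3) \<circ> b5" "b5 \<circ> (tr 1 4 \<circ> tr 2 3) = (tr 1 2 \<circ> tr 3 5) \<circ> b5"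
  "b5 \<circ> (tr 2 5 \<circ> tr 3 4) = (tr 1 5 \<circ> tr 2 4) \<circ> b5"
  by (rule perm_eqI5; auto simp: a5_def b5_def intro!: perm_intros; fail)+

lemma T5_conj: "permutes_by_conj T5 a5" "permutes_by_conj T5 b5"
  unfolding permutes_by_conj_def T5_def using a5_conj b5_conj by blast+

lemma permutes_by_conj_H1:
  assumes "p \<in> carrier H\<^sub>1" shows "permutes_by_conj T5 p"
proof (rule permutes_by_conj_generated[OF _ _ _ assms[unfolded H1_eq]])
  have "inv' a5 = a5 \<circ> (a5 \<circ> (a5 \<circ> a5))"
    by (rule inv_unique_comp; rule perm_eqI5; auto simp: a5_def intro!: perm_intros; fail)
  moreover have "inv' b5 = b5"
    by (rule inv_unique_comp; rule perm_eqI5; auto simp: b5_def intro!: perm_intros; fail)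
  ultimately show "permutes_by_conj T5 (inv' s)" if "s \<in> {a5, b5}" for s
    using that T5_conj by (auto intro!: permutes_by_conj_comp)
qed (use T5_conj in \<open>auto simp: sym_group_carrier perm5\<close>)

text \<open>The 3-cycle \<open>p\<close> carries \<open>b5\<close> to
  \<open>tr 1 2 \<circ> tr 4 5\<close>, which is no reflection of the pentagon.\<close>

lemma H1_ne_alt: "carrier H\<^sub>1 \<noteq> carrier (alt_group 5)"
proof
  assume eq: "carrier H\<^sub>1 = carrier (alt_group 5)"
  define p :: "nat \<Rightarrow> nat" where "p = tr 1 2 \<circ> tr 2 3"
  have "p \<in> carrier (alt_group 5)"
    by (auto simp: p_def alt_group_carrier evenperm_comp evenperm_swap permutation_swap_id intro!: perm_intros)
  then have "permutes_by_conj T5 p" using permutes_by_conj_H1 eq by blast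
  then obtain r where r: "r \<in> T5" "p \<circ> b5 = r \<circ> p" unfolding permutes_by_conj_def T5_def by blast
  have "p (b5 x) = r (p x)" for x using r(2) by (metis comp_apply)
  from this[of 1] this[of 2] this[of 4] r(1) show False
    by (auto simp: p_def b5_def T5_def)
qed

text \<open>Commuting with \<open>b5\<close> leaves eight permutations: \<open>2\<close> is fixed
  and the pairs \<open>{1, 3}\<close> and \<open>{4, 5}\<close> are preserved or exchanged. Four are
  odd, and two of the even ones do not preserve \<open>T5\<close>.\<close>

lemma mem_H1_if_fixes:
  assumes p: "p permutes {1..5}" "evenperm p" "permutes_by_conj T5 p" and comm: "p \<circ> b5 = b5 \<circ> p"
  shows "p \<in> carrier H\<^sub>1"
proof -
  have pb: "p (b5 x) = b5 (p x)" for x using comm by (metis comp_apply)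
  have vals: "p x \<in> {1, 2, 3, 4, 5}" if "x \<in> {1..5}" for x
  proof -
    have "p x \<in> {1..5}" using permutes_in_image[OF p(1)] that by blast
    then show ?thesis by fastforce
  qed
  have inj: "p x = p y \<longleftrightarrow> x = y" for x y using permutes_inj[OF p(1)] by (auto dest: injD)
  have b: "b5 1 = 3" "b5 2 = 2" "b5 3 = 1" "b5 4 = 5" "b5 5 = 4" by (simp_all add: b5_def)
  have "b5 (p 2) = p 2" using pb[of 2] b by simp
  then have p2: "p 2 = 2" using vals[of 2] b by auto
  have p3: "p 3 = b5 (p 1)" and p5: "p 5 = b5 (p 4)" using pb[of 1] pb[of 4] b by simp_all
  obtain r where r: "r \<in> T5" "p \<circ> (tr 2 5 \<circ> tr 3 4) = r \<circ> p"
    using p(3) unfolding permutes_by_conj_def T5_def by blast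
  have pr: "p ((tr 2 5 \<circ> tr 3 4) x) = r (p x)" for x using r(2) by (metis comp_apply)
  have pr': "p 1 = r (p 1)" "p 5 = r (p 2)" "p 4 = r (p 3)" using pr[of 1] pr[of 2] pr[of 3] by simp_all
  have odd: "p \<noteq> tr 1 3" "p \<noteq> tr 4 5" "p \<noteq> tr 1 4 \<circ> tr 4 3 \<circ> tr 3 5" "p \<noteq> tr 1 5 \<circ> tr 5 3 \<circ> tr 3 4"
    using p(2) by (auto simp: evenperm_comp evenperm_swap permutation_compose permutation_swap_id)
  note eqI = perm_eqI5[OF p(1)]
  have p14: "p 1 \<in> {1, 3, 4, 5}" "p 4 \<in> {1, 3, 4, 5}"
    using vals[of 1] vals[of 4] p2 inj[of 1 2] inj[of 4 2] by auto
  have ne: "p 1 \<noteq> p 4" "p 1 \<noteq> b5 (p 4)" using inj[of 1 4] inj[of 1 5] p5 by auto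
  have "p = id \<or> p = b5"
  proof -
    consider (1) "p 1 = 1" "p 4 = 4" | (2) "p 1 = 1" "p 4 = 5" | (3) "p 1 = 3" "p 4 = 4" | (4) "p 1 = 3" "p 4 = 5"
      | (5) "p 1 = 4" "p 4 = 1" | (6) "p 1 = 4" "p 4 = 3" | (7) "p 1 = 5" "p 4 = 1" | (8) "p 1 = 5" "p 4 = 3"
      using p14 ne b by auto
    then show ?thesis
    proof cases
      case 1
      have "p = id" by (rule eqI) (use 1 p2 p3 p5 b in auto)
      then show ?thesis ..
    next
      case 2
      have "p = tr 4 5" by (rule eqI) (use 2 p2 p3 p5 b in \<open>auto intro!: perm_intros\<close>)
      then show ?thesis using odd by blast
    next
      case 3
      have "p = tr 1 3" by (rule eqI) (use 3 p2 p3 p5 b in \<open>auto intro!: perm_intros\<close>)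
      then show ?thesis using odd by blast
    next
      case 4
      have "p = b5" by (rule eqI) (use 4 p2 p3 p5 b perm5 in auto)
      then show ?thesis ..
    next
      case 5
      \<comment> \<open>Here \<open>p\<close> would be \<open>tr 1 4 \<circ> tr 3 5\<close>, taking
        the reflection fixing \<open>1\<close> to an involution that fixes \<open>4\<close> but is
        not the reflection there.\<close>
      then have "r 4 = 4" "r 2 = 3" using pr' p2 p3 p5 b by simp_all
      then show ?thesis using r(1) unfolding T5_def b5_def by (elim insertE emptyE) simp_all
    next
      case 6
      have "p = tr 1 4 \<circ> tr 4 3 \<circ> tr 3 5" by (rule eqI) (use 6 p2 p3 p5 b in \<open>auto intro!: perm_intros\<close>)
      then show ?thesis using odd by blast
    next
      case 7
      have "p = tr 1 5 \<circ> tr 5 3 \<circ> tr 3 4" by (rule eqI) (use 7 p2 p3 p5 b in \<open>auto intro!: perm_intros\<close>)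
      then show ?thesis using odd by blast
    next
      case 8
      then have "r 5 = 5" "r 2 = 1" using pr' p2 p3 p5 b by simp_all
      then show ?thesis using r(1) unfolding T5_def b5_def by (elim insertE emptyE) simp_all
    qed
  qed
  then show ?thesis using H1_mem by blast
qed

lemma a5_pow_conj:
  "(a5 \<circ> a5) \<circ> (tr 1 4 \<circ> tr 2 3) = b5 \<circ> (a5 \<circ> a5)"
  "(a5 \<circ> (a5 \<circ> a5)) \<circ> (tr 1 2 \<circ> tr 3 5) = b5 \<circ> (a5 \<circ> (a5 \<circ> a5))"
  "(a5 \<circ> (a5 \<circ> (a5 \<circ> a5))) \<circ> (tr 1 5 \<circ> tr 2 4) = b5 \<circ> (a5 \<circ> (a5 \<circ> (a5 \<circ> a5)))"
  by (rule perm_eqI5; auto simp: a5_def b5_def intro!: perm_intros; fail)+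

text \<open>Powers of \<open>a5\<close> are transitive on the reflections, so a suitable power after
  \<open>p\<close> commutes with \<open>b5\<close> and the previous case applies.\<close>

lemma mem_H1:
  assumes p: "p \<in> carrier (alt_group 5)" "permutes_by_conj T5 p"
  shows "p \<in> carrier H\<^sub>1"
proof -
  obtain r where r: "r \<in> T5" "p \<circ> b5 = r \<circ> p" using p(2) unfolding permutes_by_conj_def T5_def by blast
  have "\<exists>w \<in> {id, a5, a5 \<circ> a5, a5 \<circ> (a5 \<circ> a5), a5 \<circ> (a5 \<circ> (a5 \<circ> a5))}. w \<circ> r = b5 \<circ> w"
    using r(1) a5_pow_conj a5_conj(5) unfolding T5_def by (elim insertE emptyE) simp_all
  then obtain w where w: "w \<in> {id, a5, a5 \<circ> a5, a5 \<circ> (a5 \<circ> a5), a5 \<circ> (a5 \<circ> (a5 \<circ> a5))}" "w \<circ> r = b5 \<circ> w" by blast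
  have wH: "w \<in> carrier H\<^sub>1" using w(1) H1_mem by auto
  have wa: "w \<in> carrier (alt_group 5)" using wH subgroup.subset[OF H1_subgroup] by blast
  have "w \<circ> p \<in> carrier (alt_group 5)"
    using subgroup.m_closed[OF group.subgroup_self[OF alt_group_is_group] wa p(1)] by (simp add: alt_group_mult)
  moreover have "permutes_by_conj T5 (w \<circ> p)"
    using permutes_by_conj_comp permutes_by_conj_H1[OF wH] p(2) by blast
  moreover have "(w \<circ> p) \<circ> b5 = b5 \<circ> (w \<circ> p)" using r(2) w(2) by (metis comp_assoc)
  ultimately have "w \<circ> p \<in> carrier H\<^sub>1" using mem_H1_if_fixes by (simp add: alt_group_carrier)
  then show ?thesis using wH generated_cancel unfolding H1_eq by blast
qed

lemma T5_pairs_covered: "pairs_covered 5 T5"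
proof -
  have "{1..5} = {1, 2, 3, 4, 5 :: nat}" by auto
  then show ?thesis by (simp add: pairs_covered_def T5_def b5_def)
qed

section \<open>The stabilizer of a total of synthemes\<close>

definition a6 :: "nat \<Rightarrow> nat" where "a6 = tr 2 3 \<circ> tr 5 6"
definition b6 :: "nat \<Rightarrow> nat" where "b6 = tr 1 4 \<circ> tr 4 5 \<circ> (tr 2 3 \<circ> tr 3 6)"
definition s6 :: "nat \<Rightarrow> nat" where "s6 = tr 1 4 \<circ> tr 2 3 \<circ> tr 5 6"

text \<open>Fixed-point-free involutions of six points correspond to synthemes; the members of \<open>T6\<close>
  correspond to the five synthemes of a total.\<close>

definition T6 :: "(nat \<Rightarrow> nat) set" where
  "T6 = {tr 1 2 \<circ> tr 3 6 \<circ> tr 4 5, tr 1 3 \<circ> tr 2 5 \<circ> tr 4 6, s6,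
    tr 1 5 \<circ> tr 2 6 \<circ> tr 3 4, tr 1 6 \<circ> tr 2 4 \<circ> tr 3 5}"

lemma perm6: "a6 permutes {1..6}" "b6 permutes {1..6}" "s6 permutes {1..6}" "r \<in> T6 \<Longrightarrow> r permutes {1..6}"
  by (auto simp: a6_def b6_def s6_def T6_def intro!: perm_intros)

lemma even6: "evenperm a6" "evenperm b6"
  by (simp_all add: a6_def b6_def evenperm_comp evenperm_swap permutation_compose permutation_swap_id)

lemma H2_eq: "H\<^sub>2 = subgroup_generated (sym_group 6) {a6, b6}"
  by (simp add: H\<^sub>2_def a6_def b6_def comp_assoc)

lemma H2_subgroup: "subgroup (carrier H\<^sub>2) (alt_group 6)"
  unfolding H2_eq by (rule subgroup_generated_alt) (simp add: alt_group_carrier perm6 even6)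

lemma H2_mem: "a6 \<in> carrier H\<^sub>2" "b6 \<in> carrier H\<^sub>2" "id \<in> carrier H\<^sub>2"
  "p \<in> carrier H\<^sub>2 \<Longrightarrow> q \<in> carrier H\<^sub>2 \<Longrightarrow> p \<circ> q \<in> carrier H\<^sub>2"
proof -
  show "p \<circ> q \<in> carrier H\<^sub>2" if "p \<in> carrier H\<^sub>2" "q \<in> carrier H\<^sub>2" for p q
    using that unfolding H2_eq by (rule generated_closed)
  show "a6 \<in> carrier H\<^sub>2" "b6 \<in> carrier H\<^sub>2"
    by (auto simp: H2_eq carrier_subgroup_generated sym_group_carrier perm6 intro!: generate.incl)
  show "id \<in> carrier H\<^sub>2"
    using generate.one[of "sym_group 6"] by (simp add: H2_eq carrier_subgroup_generated sym_group_one)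
qed

lemma H2_permutes: "p \<in> carrier H\<^sub>2 \<Longrightarrow> p permutes {1..6}"
  using subgroup.subset[OF H2_subgroup] alt_group_carrier by blast

lemma a6_conj:
  "a6 \<circ> (tr 1 2 \<circ> tr 3 6 \<circ> tr 4 5) = (tr 1 3 \<circ> tr 2 5 \<circ> tr 4 6) \<circ> a6"
  "a6 \<circ> (tr 1 3 \<circ> tr 2 5 \<circ> tr 4 6) = (tr 1 2 \<circ> tr 3 6 \<circ> tr 4 5) \<circ> a6"
  "a6 \<circ> s6 = s6 \<circ> a6"
  "a6 \<circ> (tr 1 5 \<circ> tr 2 6 \<circ> tr 3 4) = (tr 1 6 \<circ> tr 2 4 \<circ> tr 3 5) \<circ> a6"
  "a6 \<circ> (tr 1 6 \<circ> tr 2 4 \<circ> tr 3 5) = (tr 1 5 \<circ> tr 2 6 \<circ> tr 3 4) \<circ> a6"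
  by (rule perm_eqI6; auto simp: a6_def s6_def intro!: perm_intros; fail)+

lemma b6_conj:
  "b6 \<circ> (tr 1 2 \<circ> tr 3 6 \<circ> tr 4 5) = (tr 1 5 \<circ> tr 2 6 \<circ> tr 3 4) \<circ> b6"
  "b6 \<circ> (tr 1 3 \<circ> tr 2 5 \<circ> tr 4 6) = (tr 1 3 \<circ> tr 2 5 \<circ> tr 4 6) \<circ> b6"
  "b6 \<circ> s6 = (tr 1 2 \<circ> tr 3 6 \<circ> tr 4 5) \<circ> b6"
  "b6 \<circ> (tr 1 5 \<circ> tr 2 6 \<circ> tr 3 4) = s6 \<circ> b6"
  "b6 \<circ> (tr 1 6 \<circ> tr 2 4 \<circ> tr 3 5) = (tr 1 6 \<circ> tr 2 4 \<circ> tr 3 5) \<circ> b6"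
  by (rule perm_eqI6; auto simp: b6_def s6_def intro!: perm_intros; fail)+

lemma T6_conj: "permutes_by_conj T6 a6" "permutes_by_conj T6 b6"
  unfolding permutes_by_conj_def T6_def using a6_conj b6_conj by blast+

lemma permutes_by_conj_H2:
  assumes "p \<in> carrier H\<^sub>2" shows "permutes_by_conj T6 p"
proof (rule permutes_by_conj_generated[OF _ _ _ assms[unfolded H2_eq]])
  have "inv' a6 = a6"
    by (rule inv_unique_comp; rule perm_eqI6; auto simp: a6_def intro!: perm_intros; fail)
  moreover have "inv' b6 = b6 \<circ> b6"
    by (rule inv_unique_comp; rule perm_eqI6; auto simp: b6_def intro!: perm_intros; fail)
  ultimately show "permutes_by_conj T6 (inv' s)" if "s \<in> {a6, b6}" for s
    using that T6_conj by (auto intro!: permutes_by_conj_comp)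
qed (use T6_conj in \<open>auto simp: sym_group_carrier perm6\<close>)

text \<open>Conjugating \<open>s6\<close> by the 3-cycle \<open>p\<close> keeps the pair
  \<open>{1, 4}\<close>, which within \<open>T6\<close> belongs to \<open>s6\<close> alone, but
  changes the other two pairs.\<close>

lemma H2_ne_alt: "carrier H\<^sub>2 \<noteq> carrier (alt_group 6)"
proof
  assume eq: "carrier H\<^sub>2 = carrier (alt_group 6)"
  define p :: "nat \<Rightarrow> nat" where "p = tr 2 3 \<circ> tr 3 5"
  have "p \<in> carrier (alt_group 6)"
    by (auto simp: p_def alt_group_carrier evenperm_comp evenperm_swap permutation_swap_id intro!: perm_intros)
  then have "permutes_by_conj T6 p" using permutes_by_conj_H2 eq by blast
  then obtain r where r: "r \<in> T6" "p \<circ> s6 = r \<circ> p" unfolding permutes_by_conj_def T6_def by blast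
  have "p (s6 x) = r (p x)" for x using r(2) by (metis comp_apply)
  from this[of 1] this[of 2] have "r 1 = 4" "r 3 = 5"
    by (simp_all add: p_def s6_def)
  then show False using r(1) unfolding T6_def s6_def by (elim insertE emptyE) simp_all
qed

text \<open>With \<open>1\<close> and \<open>4\<close> fixed, \<open>p\<close> preserves or
  exchanges the pairs \<open>{2, 3}\<close> and \<open>{5, 6}\<close>. Of the eight possibilities
  four are odd; the two even exchanges throw \<open>tr 1 2 \<circ> tr 3 6 \<circ> tr 4 5\<close> out
  of \<open>T6\<close>.\<close>

lemma mem_H2_if_fixes:
  assumes p: "p permutes {1..6}" "evenperm p" "permutes_by_conj T6 p" and comm: "p \<circ> s6 = s6 \<circ> p"
    and p1: "p 1 = 1"
  shows "p \<in> carrier H\<^sub>2"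
proof -
  have pb: "p (s6 x) = s6 (p x)" for x using comm by (metis comp_apply)
  have vals: "p x \<in> {1, 2, 3, 4, 5, 6}" if "x \<in> {1..6}" for x
  proof -
    have "p x \<in> {1..6}" using permutes_in_image[OF p(1)] that by blast
    then show ?thesis by fastforce
  qed
  have inj: "p x = p y \<longleftrightarrow> x = y" for x y using permutes_inj[OF p(1)] by (auto dest: injD)
  have b: "s6 1 = 4" "s6 2 = 3" "s6 3 = 2" "s6 4 = 1" "s6 5 = 6" "s6 6 = 5" by (simp_all add: s6_def)
  have p4: "p 4 = 4" and p3: "p 3 = s6 (p 2)" and p6: "p 6 = s6 (p 5)"
    using pb[of 1] pb[of 2] pb[of 5] b p1 by simp_all
  obtain r where r: "r \<in> T6" "p \<circ> (tr 1 2 \<circ> tr 3 6 \<circ> tr 4 5) = r \<circ> p"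
    using p(3) unfolding permutes_by_conj_def T6_def by blast
  have pr: "p ((tr 1 2 \<circ> tr 3 6 \<circ> tr 4 5) x) = r (p x)" for x using r(2) by (metis comp_apply)
  have pr': "r 1 = p 2" "r 4 = p 5" using pr[of 1] pr[of 4] p1 p4 by simp_all
  have odd: "p \<noteq> tr 2 3" "p \<noteq> tr 5 6" "p \<noteq> tr 2 5 \<circ> tr 5 3 \<circ> tr 3 6" "p \<noteq> tr 2 6 \<circ> tr 6 3 \<circ> tr 3 5"
    using p(2) by (auto simp: evenperm_comp evenperm_swap permutation_compose permutation_swap_id)
  note eqI = perm_eqI6[OF p(1)]
  have p25: "p 2 \<in> {2, 3, 5, 6}" "p 5 \<in> {2, 3, 5, 6}"
    using vals[of 2] vals[of 5] p1 p4 inj[of 2 1] inj[of 2 4] inj[of 5 1] inj[of 5 4] by auto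
  have ne: "p 2 \<noteq> p 5" "p 2 \<noteq> s6 (p 5)" using inj[of 2 5] inj[of 2 6] p6 by auto
  have "p = id \<or> p = a6"
  proof -
    consider (1) "p 2 = 2" "p 5 = 5" | (2) "p 2 = 2" "p 5 = 6" | (3) "p 2 = 3" "p 5 = 5" | (4) "p 2 = 3" "p 5 = 6"
      | (5) "p 2 = 5" "p 5 = 2" | (6) "p 2 = 5" "p 5 = 3" | (7) "p 2 = 6" "p 5 = 2" | (8) "p 2 = 6" "p 5 = 3"
      using p25 ne b by auto
    then show ?thesis
    proof cases
      case 1
      have "p = id" by (rule eqI) (use 1 p1 p3 p4 p6 b in auto)
      then show ?thesis ..
    next
      case 2
      have "p = tr 5 6" by (rule eqI) (use 2 p1 p3 p4 p6 b in \<open>auto intro!: perm_intros\<close>)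
      then show ?thesis using odd by blast
    next
      case 3
      have "p = tr 2 3" by (rule eqI) (use 3 p1 p3 p4 p6 b in \<open>auto intro!: perm_intros\<close>)
      then show ?thesis using odd by blast
    next
      case 4
      have "p = a6" by (rule eqI) (use 4 p1 p3 p4 p6 b in \<open>auto simp: a6_def intro!: perm_intros\<close>)
      then show ?thesis ..
    next
      case 5
      then have "r 1 = 5" "r 4 = 2" using pr' by simp_all
      then show ?thesis using r(1) unfolding T6_def s6_def by (elim insertE emptyE) simp_all
    next
      case 6
      have "p = tr 2 5 \<circ> tr 5 3 \<circ> tr 3 6" by (rule eqI) (use 6 p1 p3 p4 p6 b in \<open>auto intro!: perm_intros\<close>)
      then show ?thesis using odd by blast
    next
      case 7
      have "p = tr 2 6 \<circ> tr 6 3 \<circ> tr 3 5" by (rule eqI) (use 7 p1 p3 p4 p6 b in \<open>auto intro!: perm_intros\<close>)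
      then show ?thesis using odd by blast
    next
      case 8
      then have "r 1 = 6" "r 4 = 3" using pr' by simp_all
      then show ?thesis using r(1) unfolding T6_def s6_def by (elim insertE emptyE) simp_all
    qed
  qed
  then show ?thesis using H2_mem by blast
qed

text \<open>The centralizer of \<open>s6\<close> in \<open>H\<^sub>2\<close> is transitive on the
  six points.\<close>

lemma H2_centralizer:
  assumes "j \<in> {1..6}"
  shows "\<exists>c \<in> carrier H\<^sub>2. c \<circ> s6 = s6 \<circ> c \<and> c j = 1"
proof -
  \<comment> \<open>The words \<open>c3\<close> and \<open>c5\<close> commute with \<open>s6\<close>
    and send \<open>3\<close>, respectively \<open>5\<close>, to \<open>1\<close>. The points
    \<open>2\<close>, \<open>6\<close> and \<open>4\<close> are first moved to \<open>3\<close> or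
    \<open>5\<close> by \<open>a6\<close> or \<open>c3\<close>.\<close>
  define c3 where "c3 = b6 \<circ> (a6 \<circ> (b6 \<circ> (a6 \<circ> (b6 \<circ> b6))))"
  define c5 where "c5 = b6 \<circ> (b6 \<circ> (a6 \<circ> (b6 \<circ> (a6 \<circ> b6))))"
  have mem: "c3 \<in> carrier H\<^sub>2" "c5 \<in> carrier H\<^sub>2" by (simp_all add: c3_def c5_def H2_mem)
  have v3: "c3 1 = 6" "c3 2 = 4" "c3 3 = 1" "c3 4 = 5" "c3 5 = 2" "c3 6 = 3"
    by (simp_all add: c3_def a6_def b6_def)
  have v5: "c5 1 = 3" "c5 2 = 6" "c5 3 = 5" "c5 4 = 2" "c5 5 = 1" "c5 6 = 4"
    by (simp_all add: c5_def a6_def b6_def)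
  have comm: "c3 \<circ> s6 = s6 \<circ> c3" "c5 \<circ> s6 = s6 \<circ> c5"
    by (rule perm_eqI6; simp add: v3 v5 s6_def H2_permutes mem permutes_compose[OF perm6(3)[unfolded s6_def]] 
        permutes_compose[OF _ perm6(3)[unfolded s6_def]]; fail)+
  have comm': "(c3 \<circ> a6) \<circ> s6 = s6 \<circ> (c3 \<circ> a6)" "(c5 \<circ> a6) \<circ> s6 = s6 \<circ> (c5 \<circ> a6)"
    "(c5 \<circ> c3) \<circ> s6 = s6 \<circ> (c5 \<circ> c3)"
    using comm a6_conj(3) by (metis comp_assoc)+
  have "a6 6 = 5" "a6 2 = 3" by (simp_all add: a6_def)
  then have v: "(c3 \<circ> a6) 2 = 1" "(c5 \<circ> a6) 6 = 1" "(c5 \<circ> c3) 4 = 1" using v3 v5 by simp_all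
  have m: "c3 \<circ> a6 \<in> carrier H\<^sub>2" "c5 \<circ> a6 \<in> carrier H\<^sub>2" "c5 \<circ> c3 \<in> carrier H\<^sub>2"
    using mem H2_mem by blast+
  have "id 1 = (1 :: nat)" "id \<circ> s6 = s6 \<circ> id" by simp_all
  moreover have "j = 1 \<or> j = 2 \<or> j = 3 \<or> j = 4 \<or> j = 5 \<or> j = 6" using assms by fastforce
  ultimately show ?thesis using m mem v comm comm' v3 v5 H2_mem(3) by metis
qed

text \<open>Two corrections from \<open>H\<^sub>2\<close> reduce \<open>p\<close> to the previous
  case: \<open>w\<close> makes it commute with \<open>s6\<close>, using transitivity on
  \<open>T6\<close>, and \<open>c\<close> from the centralizer makes it fix
  \<open>1\<close>.\<close>

lemma mem_H2:
  assumes p: "p \<in> carrier (alt_group 6)" "permutes_by_conj T6 p"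
  shows "p \<in> carrier H\<^sub>2"
proof -
  have closed: "w \<circ> q \<in> carrier (alt_group 6) \<and> permutes_by_conj T6 (w \<circ> q)"
    if "w \<in> carrier H\<^sub>2" "q \<in> carrier (alt_group 6)" "permutes_by_conj T6 q" for w q
  proof -
    have "w \<in> carrier (alt_group 6)" using that(1) subgroup.subset[OF H2_subgroup] by blast
    then show ?thesis
      using subgroup.m_closed[OF group.subgroup_self[OF alt_group_is_group] _ that(2)]
        permutes_by_conj_comp[OF permutes_by_conj_H2[OF that(1)] that(3)] by (simp add: alt_group_mult)
  qed
  obtain r where r: "r \<in> T6" "p \<circ> s6 = r \<circ> p" using p(2) unfolding permutes_by_conj_def T6_def by blast
  have words: "(b6 \<circ> b6) \<circ> (tr 1 2 \<circ> tr 3 6 \<circ> tr 4 5) = s6 \<circ> (b6 \<circ> b6)"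
    "(b6 \<circ> (b6 \<circ> a6)) \<circ> (tr 1 3 \<circ> tr 2 5 \<circ> tr 4 6) = s6 \<circ> (b6 \<circ> (b6 \<circ> a6))"
    "(b6 \<circ> a6) \<circ> (tr 1 6 \<circ> tr 2 4 \<circ> tr 3 5) = s6 \<circ> (b6 \<circ> a6)"
    by (rule perm_eqI6; auto simp: a6_def b6_def s6_def intro!: perm_intros; fail)+
  have "\<exists>w \<in> {id, b6, b6 \<circ> b6, b6 \<circ> (b6 \<circ> a6), b6 \<circ> a6}. w \<circ> r = s6 \<circ> w"
    using r(1) words b6_conj(4) unfolding T6_def by (elim insertE emptyE) simp_all
  then obtain w where w: "w \<in> {id, b6, b6 \<circ> b6, b6 \<circ> (b6 \<circ> a6), b6 \<circ> a6}" "w \<circ> r = s6 \<circ> w" by blast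
  have wH: "w \<in> carrier H\<^sub>2" using w(1) H2_mem by auto
  have wp: "w \<circ> p \<in> carrier (alt_group 6)" "permutes_by_conj T6 (w \<circ> p)" using closed[OF wH p] by auto
  have wpc: "(w \<circ> p) \<circ> s6 = s6 \<circ> (w \<circ> p)" using r(2) w(2) by (metis comp_assoc)
  have "(w \<circ> p) 1 \<in> {1..6}"
    using wp(1) permutes_in_image[of "w \<circ> p" "{1..6}" 1] by (simp add: alt_group_carrier)
  then obtain c where c: "c \<in> carrier H\<^sub>2" "c \<circ> s6 = s6 \<circ> c" "c ((w \<circ> p) 1) = 1"
    using H2_centralizer by blast
  have cwp: "c \<circ> (w \<circ> p) \<in> carrier (alt_group 6)" "permutes_by_conj T6 (c \<circ> (w \<circ> p))"
    using closed[OF c(1) wp] by auto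
  have "(c \<circ> (w \<circ> p)) \<circ> s6 = s6 \<circ> (c \<circ> (w \<circ> p))" using c(2) wpc by (metis comp_assoc)
  then have "c \<circ> (w \<circ> p) \<in> carrier H\<^sub>2"
    using mem_H2_if_fixes cwp c(3) by (simp add: alt_group_carrier)
  then show ?thesis using c(1) wH generated_cancel unfolding H2_eq by blast
qed

lemma T6_pairs_covered: "pairs_covered 6 T6"
proof -
  have "{1..6} = {1, 2, 3, 4, 5, 6 :: nat}" by auto
  then show ?thesis by (simp add: pairs_covered_def T6_def s6_def)
qed

section \<open>The two exceptional graphs\<close>

text \<open>In the next two lemmas the first four involutions belong to \<open>T5\<close>, respectively \<open>T6\<close>, and the
  other four are their conjugates by a transposition of the last two points.\<close>

lemma involution_5_cases:
  fixes m :: "nat \<Rightarrow> nat"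
  assumes vals: "m 1 \<in> {1, 2, 3, 4, 5}" "m 2 \<in> {1, 2, 3, 4, 5}"
      "m 3 \<in> {1, 2, 3, 4, 5}" "m 4 \<in> {1, 2, 3, 4, 5}" "m 5 \<in> {1, 2, 3, 4, 5}"
    and inv: "m (m 1) = 1" "m (m 2) = 2" "m (m 3) = 3" "m (m 4) = 4" "m (m 5) = 5"
    and ne: "m 1 \<noteq> 3" "m 4 \<noteq> 5" "m 2 \<noteq> 2"
    and fp: "\<And>x y. x \<in> {1, 3, 4, 5} \<Longrightarrow> y \<in> {1, 3, 4, 5} \<Longrightarrow> m x = x \<Longrightarrow> m y = y \<Longrightarrow> x = y"
  shows "(m 1, m 2, m 3, m 4, m 5) \<in> {(1, 5, 4, 3, 2), (5, 4, 3, 2, 1), (2, 1, 5, 4, 3), (4, 3, 2, 1, 5),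
     (1, 4, 5, 2, 3), (4, 5, 3, 1, 2), (2, 1, 4, 3, 5), (5, 3, 2, 4, 1)}"
proof -
  have n: "\<not> (m 1 = 1 \<and> m 3 = 3)" "\<not> (m 1 = 1 \<and> m 4 = 4)" "\<not> (m 1 = 1 \<and> m 5 = 5)"
     "\<not> (m 3 = 3 \<and> m 4 = 4)" "\<not> (m 3 = 3 \<and> m 5 = 5)" "\<not> (m 4 = 4 \<and> m 5 = 5)"
    using fp[of 1 3] fp[of 1 4] fp[of 1 5] fp[of 3 4] fp[of 3 5] fp[of 4 5] by auto
  have v: "m 1 = 1 \<or> m 1 = 2 \<or> m 1 = 4 \<or> m 1 = 5" "m 2 = 1 \<or> m 2 = 3 \<or> m 2 = 4 \<or> m 2 = 5"
    "m 3 = 1 \<or> m 3 = 2 \<or> m 3 = 3 \<or> m 3 = 4 \<or> m 3 = 5" 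
    "m 4 = 1 \<or> m 4 = 2 \<or> m 4 = 3 \<or> m 4 = 4" "m 5 = 1 \<or> m 5 = 2 \<or> m 5 = 3 \<or> m 5 = 4 \<or> m 5 = 5"
    using vals ne by auto
  from v(1,4) have "m 1 = 1 \<and> m 4 = 2 \<and> m 2 = 4 \<or> m 1 = 1 \<and> m 4 = 3 \<and> m 3 = 4 \<or>
      m 1 = 2 \<and> m 4 = 3 \<and> m 2 = 1 \<and> m 3 = 4 \<or> m 1 = 2 \<and> m 4 = 4 \<and> m 2 = 1 \<or> m 1 = 4 \<and> m 4 = 1 \<or>
      m 1 = 5 \<and> m 4 = 2 \<and> m 5 = 1 \<and> m 2 = 4 \<or> m 1 = 5 \<and> m 4 = 3 \<and> m 5 = 1 \<and> m 3 = 4 \<or> m 1 = 5 \<and> m 4 = 4 \<and> m 5 = 1"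
    using inv(1,4) n(2) by (elim disjE) simp_all
  then consider "m 1 = 1" "m 4 = 2" "m 2 = 4" | "m 1 = 1" "m 4 = 3" "m 3 = 4" |
      "m 1 = 2" "m 4 = 3" "m 2 = 1" "m 3 = 4" | "m 1 = 2" "m 4 = 4" "m 2 = 1" | "m 1 = 4" "m 4 = 1" |
      "m 1 = 5" "m 4 = 2" "m 5 = 1" "m 2 = 4" | "m 1 = 5" "m 4 = 3" "m 5 = 1" "m 3 = 4" | "m 1 = 5" "m 4 = 4" "m 5 = 1"
    by (elim disjE conjE) blast+
  then show ?thesis
  proof cases
    case 1
    then show ?thesis using v(2,3,5) inv(2,3,5) n by auto
  next
    case 2
    then show ?thesis using v(2,3,5) inv(2,3,5) n by auto
  next
    case 3
    then show ?thesis using v(2,3,5) inv(2,3,5) n by auto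
  next
    case 4
    then show ?thesis using v(2,3,5) inv(2,3,5) n by auto
  next
    case 5
    \<comment> \<open>With \<open>1\<close> and \<open>4\<close> exchanged, \<open>2\<close> is not
      fixed and must be paired with \<open>3\<close> or \<open>5\<close>; the remaining point is
      fixed.\<close>
    have "m 2 \<noteq> 1" "m 2 \<noteq> 4" using inv(2) 5 by auto
    then consider "m 2 = 3" "m 3 = 2" | "m 2 = 5" "m 5 = 2" using v(2) inv(2) by metis
    then show ?thesis
    proof cases
      case 1
      have "m 5 \<noteq> 1" "m 5 \<noteq> 2" "m 5 \<noteq> 3" "m 5 \<noteq> 4" using inv(5) 5 1 by auto
      then show ?thesis using v(5) 5 1 by simp
    next
      case 2
      have "m 3 \<noteq> 1" "m 3 \<noteq> 2" "m 3 \<noteq> 4" "m 3 \<noteq> 5" using inv(3) 5 2 by auto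
      then show ?thesis using v(3) 5 2 by simp
    qed
  next
    case 6
    then show ?thesis using v(2,3,5) inv(2,3,5) n by auto
  next
    case 7
    then show ?thesis using v(2,3,5) inv(2,3,5) n by auto
  next
    case 8
    then show ?thesis using v(2,3,5) inv(2,3,5) n by auto
  qed
qed

lemma involution_6_cases:
  fixes m :: "nat \<Rightarrow> nat"
  assumes vals: "m 1 \<in> {1, 2, 3, 4, 5, 6}" "m 2 \<in> {1, 2, 3, 4, 5, 6}" "m 3 \<in> {1, 2, 3, 4, 5, 6}"
      "m 4 \<in> {1, 2, 3, 4, 5, 6}" "m 5 \<in> {1, 2, 3, 4, 5, 6}" "m 6 \<in> {1, 2, 3, 4, 5, 6}"
    and inv: "m (m 1) = 1" "m (m 2) = 2" "m (m 3) = 3" "m (m 4) = 4" "m (m 5) = 5" "m (m 6) = 6"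
    and ne: "m 1 \<noteq> 4" "m 2 \<noteq> 3" "m 5 \<noteq> 6"
    and fp: "m 1 \<noteq> 1" "m 2 \<noteq> 2" "m 3 \<noteq> 3" "m 4 \<noteq> 4" "m 5 \<noteq> 5" "m 6 \<noteq> 6"
  shows "(m 1, m 2, m 3, m 4, m 5, m 6) \<in> {(2,1,6,5,4,3), (3,5,1,6,2,4), (5,6,4,3,1,2), (6,4,5,2,3,1),
     (2,1,5,6,3,4), (3,6,1,5,4,2), (6,5,4,3,2,1), (5,4,6,2,1,3)}"
proof -
  have "m 1 = 2 \<or> m 1 = 3 \<or> m 1 = 5 \<or> m 1 = 6" using vals(1) ne fp by auto
  moreover have "m 4 = 2 \<or> m 4 = 3 \<or> m 4 = 5 \<or> m 4 = 6" using vals(4) ne fp inv(4) by auto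
  ultimately show ?thesis
    using vals(2,3,5,6) inv ne fp
    by (elim disjE) (simp; fail | (auto; fail))+
qed

context alt_primitive_bad
begin

lemma s0_conjugates_conj_mem:
  assumes s: "s \<circ> s = id" and g: "s \<circ> g \<circ> s \<in> H" and r: "s \<circ> r \<circ> s \<in> s0_conjugates" and eq: "g \<circ> r = r' \<circ> g"
  shows "s \<circ> r' \<circ> s \<in> s0_conjugates"
proof -
  have ss: "s (s x) = x" for x using s by (metis comp_apply id_apply)
  have "(s \<circ> g \<circ> s) \<circ> (s \<circ> r \<circ> s) = (s \<circ> r' \<circ> s) \<circ> (s \<circ> g \<circ> s)"
    using fun_cong[OF eq] by (simp add: fun_eq_iff ss)
  from s0_conjugates_eqI[OF g r this] show ?thesis .
qed

text \<open>Of use for \<open>n = 5\<close>, where \<open>s0\<close> is even and the conjugates can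
  themselves conjugate one another; \<open>s6\<close> is odd.\<close>

lemma s0_conjugates_subset_H: "s0 \<in> H \<Longrightarrow> m \<in> s0_conjugates \<Longrightarrow> m \<in> H"
  by (metis s0_conjugates_form H_comp H_inv)

text \<open>Two different reflections of a pentagon generate its dihedral group, so conjugating
  \<open>b5\<close> and \<open>m\<close> by one another reaches all five reflections.\<close>

lemma T5_conjugates:
  assumes n: "n = 5" and s0: "s0 = b5" "b5 \<in> H" and s: "s \<circ> s = id" "s \<circ> b5 \<circ> s = b5"
    and m: "m \<in> T5" "m \<noteq> b5" "s \<circ> m \<circ> s \<in> s0_conjugates" and r: "r \<in> T5"
  shows "s \<circ> r \<circ> s \<in> s0_conjugates"
proof -
  let ?r1 = "tr 2 5 \<circ> tr 3 4" and ?r3 = "tr 1 5 \<circ> tr 2 4" and ?r4 = "tr 1 2 \<circ> tr 3 5" and ?r5 = "tr 1 4 \<circ> tr 2 3"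
  have OmH: "x \<in> H" if "x \<in> s0_conjugates" for x using s0_conjugates_subset_H that s0 by simp
  have b: "s \<circ> b5 \<circ> s \<in> s0_conjugates" using s0 s s0_conjugates_s0 by simp
  have step: "s \<circ> y \<circ> s \<in> s0_conjugates" if "s \<circ> g \<circ> s \<in> s0_conjugates" "s \<circ> x \<circ> s \<in> s0_conjugates" "g \<circ> x = y \<circ> g" for g x y
    using s0_conjugates_conj_mem[OF s(1) OmH[OF that(1)] that(2,3)] .
  have conj: "b5 \<circ> ?r3 = ?r1 \<circ> b5" "?r4 \<circ> b5 = ?r1 \<circ> ?r4" "?r5 \<circ> b5 = ?r3 \<circ> ?r5"
    "b5 \<circ> ?r1 = ?r3 \<circ> b5" "?r1 \<circ> b5 = ?r5 \<circ> ?r1" "?r3 \<circ> b5 = ?r4 \<circ> ?r3"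
    by (rule perm_eqI5; auto simp: b5_def intro!: perm_intros; fail)+
  have "s \<circ> ?r1 \<circ> s \<in> s0_conjugates"
  proof -
    consider "m = ?r1" | "m = ?r3" | "m = ?r4" | "m = ?r5" using m(1,2) unfolding T5_def by blast
    then show ?thesis using m(3) b step conj(1,2,3) by cases metis+
  qed
  then show ?thesis using r b step conj(4,5,6) unfolding T5_def by (metis insertE singletonD)
qed

lemma exceptional_5_2:
  assumes n: "n = 5" and k: "k = 2" and s0: "s0 = b5"
  shows "primitive_decomposition (sym_group n) (johnson_act n k) (johnson n k) \<P> \<or>
    isomorphic_decompositions (johnson 5 2) \<P> \<P>\<^sub>1"
proof (cases "\<forall>g \<in> H. g 2 = 2")
  case True
  \<comment> \<open>By maximality \<open>H\<close> is the full stabilizer of the point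
    \<open>2\<close>, which the transposition \<open>tr 4 5\<close> normalizes.\<close>
  define K where "K = {p \<in> carrier (alt_group n). p 2 = 2}"
  have "subgroup K (alt_group n)"
  proof (rule alt_subgroupI)
    show "inv' p \<in> K" if "p \<in> K" for p
      using that alt_group_inv_closed[of p n] permutes_inverses(2)[of p "{1..n}" 2]
      by (simp add: K_def alt_group_carrier)
    show "p \<circ> q \<in> K" if "p \<in> K" "q \<in> K" for p q
      using that alt_comp by (simp add: K_def)
  qed (auto simp: K_def alt_group_carrier permutes_id)
  moreover have "H \<subseteq> K" using True H_alt by (auto simp: K_def)
  moreover have "K \<noteq> carrier (alt_group n)"
  proof -
    have "tr 1 2 \<circ> tr 2 3 \<in> carrier (alt_group n)" by (rule tr_tr_alt) (simp_all add: n)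
    moreover have "tr 1 2 \<circ> tr 2 3 \<notin> K" by (simp add: K_def)
    ultimately show ?thesis by blast
  qed
  ultimately have KH: "K = H" using H_maximal by blast
  have t: "tr 4 5 permutes {1..n}" "permutation (tr 4 5 :: nat \<Rightarrow> nat)"
    by (auto simp: n permutation_swap_id intro!: perm_intros)
  have "cell 4 = cell 5" unfolding cell_def unfolding k by simp
  then have "act (tr 4 5) e0 = e0" by (rule act_tr_e0) simp_all
  moreover have "tr 4 5 \<circ> h \<circ> tr 4 5 \<in> H" if "h \<in> H" for h
  proof -
    have h: "h permutes {1..n}" "evenperm h" "h 2 = 2"
      using H_alt[OF that] True that by (auto simp: alt_group_carrier)
    then have "permutation h" using permutation_permutes by blast
    then show ?thesis
      unfolding KH[symmetric] using h t
      by (simp add: K_def alt_group_carrier permutes_compose evenperm_comp permutation_compose)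
  qed
  ultimately show ?thesis
    using sym_primitive_if_normalizes[of "tr 4 5"] t by (simp add: evenperm_swap)
next
  case False
  then obtain g where g: "g \<in> H" "g 2 \<noteq> 2" by blast
  note pg = H_permutes[OF g(1)]
  obtain m where m: "m \<in> s0_conjugates" "g \<circ> s0 = m \<circ> g" using s0_conjugates_conj[OF g(1) s0_conjugates_s0] by blast
  have mg: "m (g x) = g (b5 x)" for x using m(2) s0 by (metis comp_apply)
  have ginj: "g a = g b \<longleftrightarrow> a = b" for a b using permutes_inj[OF pg] by (auto dest: injD)
  have b: "b5 1 = 3" "b5 2 = 2" "b5 3 = 1" "b5 4 = 5" "b5 5 = 4" by (simp_all add: b5_def)
  have in5: "x \<in> {1, 2, 3, 4, 5} \<longleftrightarrow> x \<in> {1..n}" for x by (auto simp: n)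
  have fp: "m x = x \<longleftrightarrow> x = g 2" if x: "x \<in> {1, 2, 3, 4, 5}" for x
  proof -
    obtain w where w: "x = g w" "w \<in> {1..n}"
      using x permutes_image[OF pg] unfolding in5 by blast
    have "b5 w = w \<longleftrightarrow> w = 2" using w(2) b unfolding in5[symmetric] by auto
    then show ?thesis unfolding w(1) mg ginj .
  qed
  \<comment> \<open>A common moved value would give \<open>m = b5\<close>, but the fixed point of
    \<open>m\<close> is \<open>g 2\<close> and not \<open>2\<close>.\<close>
  have ne: "m x \<noteq> b5 x" if "b5 x \<noteq> x" for x
  proof
    assume "m x = b5 x"
    then have "m = b5" using s0_conjugates_meets[OF m(1) s0_conjugates_s0, of x] s0 that by simp
    then have "b5 (g 2) = g 2" using mg[of 2] b by simp
    moreover have "g 2 \<in> {1, 2, 3, 4, 5}" unfolding in5 using H_in[OF g(1)] n by simp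
    ultimately show False using g(2) b by auto
  qed
  have vals: "m x \<in> {1, 2, 3, 4, 5}" if "x \<in> {1, 2, 3, 4, 5}" for x
    using permutes_in_image[OF s0_conjugates_permutes[OF m(1)]] that unfolding in5 by blast
  have tuple: "(m 1, m 2, m 3, m 4, m 5) \<in> {(1, 5, 4, 3, 2), (5, 4, 3, 2, 1), (2, 1, 5, 4, 3), (4, 3, 2, 1, 5),
     (1, 4, 5, 2, 3), (4, 5, 3, 1, 2), (2, 1, 4, 3, 5), (5, 3, 2, 4, 1)}"
  proof (rule involution_5_cases)
    show "m 1 \<noteq> 3" "m 4 \<noteq> 5" using ne[of 1] ne[of 4] b by auto
    show "m 2 \<noteq> 2" using fp[of 2] g(2) by auto
    show "x = y" if "x \<in> {1, 3, 4, 5}" "y \<in> {1, 3, 4, 5}" "m x = x" "m y = y" for x y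
      using fp[of x] fp[of y] that by auto
  qed ((rule vals, simp; fail | rule s0_conjugates_invol[OF m(1)])+)
  define t :: "nat \<Rightarrow> nat" where "t = tr 4 5"
  have pm: "m permutes {1..5}" using s0_conjugates_permutes[OF m(1)] n by simp
  have "\<exists>s \<in> {id, t}. \<exists>r \<in> T5. r \<noteq> b5 \<and> m = s \<circ> r \<circ> s"
  proof -
    let ?r1 = "tr 2 5 \<circ> tr 3 4" and ?r3 = "tr 1 5 \<circ> tr 2 4" and ?r4 = "tr 1 2 \<circ> tr 3 5" and ?r5 = "tr 1 4 \<circ> tr 2 3"
    have r: "?r1 \<in> T5" "?r3 \<in> T5" "?r4 \<in> T5" "?r5 \<in> T5" by (simp_all add: T5_def)
    have "?r1 1 \<noteq> b5 1" "?r3 1 \<noteq> b5 1" "?r4 1 \<noteq> b5 1" "?r5 1 \<noteq> b5 1" by (simp_all add: b5_def)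
    then have rb: "?r1 \<noteq> b5" "?r3 \<noteq> b5" "?r4 \<noteq> b5" "?r5 \<noteq> b5" by metis+
    have "m = id \<circ> ?r1 \<circ> id \<or> m = id \<circ> ?r3 \<circ> id \<or> m = id \<circ> ?r4 \<circ> id \<or> m = id \<circ> ?r5 \<circ> id \<or>
        m = t \<circ> ?r1 \<circ> t \<or> m = t \<circ> ?r3 \<circ> t \<or> m = t \<circ> ?r4 \<circ> t \<or> m = t \<circ> ?r5 \<circ> t"
      using tuple
    proof (elim insertE emptyE, goal_cases)
        case 1
        have "m = id \<circ> ?r1 \<circ> id" by (rule perm_eqI5[OF pm]) (use 1 in \<open>auto intro!: perm_intros\<close>)
        then show ?case by blast
      next
        case 2
        have "m = id \<circ> ?r3 \<circ> id" by (rule perm_eqI5[OF pm]) (use 2 in \<open>auto intro!: perm_intros\<close>)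
        then show ?case by blast
      next
        case 3
        have "m = id \<circ> ?r4 \<circ> id" by (rule perm_eqI5[OF pm]) (use 3 in \<open>auto intro!: perm_intros\<close>)
        then show ?case by blast
      next
        case 4
        have "m = id \<circ> ?r5 \<circ> id" by (rule perm_eqI5[OF pm]) (use 4 in \<open>auto intro!: perm_intros\<close>)
        then show ?case by blast
      next
        case 5
        have "m = t \<circ> ?r1 \<circ> t" by (rule perm_eqI5[OF pm]) (use 5 in \<open>auto simp: t_def intro!: perm_intros\<close>)
        then show ?case by blast
      next
        case 6
        have "m = t \<circ> ?r3 \<circ> t" by (rule perm_eqI5[OF pm]) (use 6 in \<open>auto simp: t_def intro!: perm_intros\<close>)
        then show ?case by blast
      next
        case 7
        have "m = t \<circ> ?r4 \<circ> t" by (rule perm_eqI5[OF pm]) (use 7 in \<open>auto simp: t_def intro!: perm_intros\<close>)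
        then show ?case by blast
      next
        case 8
        have "m = t \<circ> ?r5 \<circ> t" by (rule perm_eqI5[OF pm]) (use 8 in \<open>auto simp: t_def intro!: perm_intros\<close>)
        then show ?case by blast
    qed
    then show ?thesis
    proof (elim disjE)
    qed ((rule bexI[of _ id] bexI[of _ t], rule bexI, rule conjI[rotated], assumption, rule rb, rule r, simp)+)
  qed
  then obtain s where s: "s \<in> {id, t}" and "\<exists>r \<in> T5. r \<noteq> b5 \<and> m = s \<circ> r \<circ> s" by (rule bexE)
  then obtain r where "r \<in> T5" "r \<noteq> b5 \<and> m = s \<circ> r \<circ> s" by (elim bexE)
  then have r: "r \<in> T5" "r \<noteq> b5" "m = s \<circ> r \<circ> s" by simp_all
  have c: "cell 1 = cell 3" "cell 4 = cell 5" unfolding cell_def unfolding k by simp_all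
  have bH: "b5 \<in> H" unfolding b5_def by (rule cell_tr_tr[OF _ _ _ _ _ _ c]) (simp_all add: n)
  have s': "s permutes {1..n}" "s \<circ> s = id" "act s e0 = e0"
  proof -
    have "t permutes {1..n}" unfolding t_def by (rule permutes_swap_id) (simp_all add: n)
    moreover have "t \<circ> t = id" unfolding t_def by (rule transpose_comp_involutory)
    moreover have "act t e0 = e0" unfolding t_def by (rule act_tr_e0[OF c(2)]) simp_all
    moreover have "s = id \<or> s = t" using s by blast
    ultimately show "s permutes {1..n}" "s \<circ> s = id" "act s e0 = e0"
      using permutes_id act_id id_comp by metis+
  qed
  have sb: "s \<circ> b5 \<circ> s = b5"
  proof -
    have "t \<circ> b5 \<circ> t = b5" by (rule perm_eqI5) (auto simp: t_def b5_def intro!: perm_intros)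
    then show ?thesis using s by auto
  qed
  have e0: "e0 = {{1, 2}, {2, 3}}"
  proof -
    have "{1..2} = {1, 2 :: nat}" "{2..2 + 1} = {2, 3 :: nat}" by auto
    then show ?thesis unfolding e0_def unfolding k by (simp only:)
  qed
  have "isomorphic_decompositions (johnson n k) \<P> (orbit (alt_group n) (part_act (johnson_act n k)) P\<^sub>1)"
  proof (rule isomorphic_if_cover[OF s', of T5 "H\<^sub>1"])
    show "s \<circ> r' \<circ> s \<in> s0_conjugates" if "r' \<in> T5" for r'
      using T5_conjugates[OF n s0 bH s'(2) sb r(1,2) _ that] r(3) m(1) by simp
    show "P\<^sub>1 = orbit H\<^sub>1 (edge_act (johnson_act n k)) e0" unfolding P\<^sub>1_def e0 unfolding n k by (rule refl)
  qed (simp_all add: n T5_pairs_covered H1_subgroup H1_ne_alt mem_H1)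
  then show ?thesis by (simp add: \<P>\<^sub>1_def n k)
qed

text \<open>The even products of the three cell transpositions form, with the identity, a Klein
  four-group in \<open>H\<close>. It commutes with \<open>s\<close> and is transitive on the four
  members of \<open>T6\<close> other than \<open>s6\<close>, so one of them yields all.\<close>

lemma T6_conjugates:
  assumes n: "n = 6" and s0: "s0 = s6"
    and E: "tr 1 4 \<circ> tr 2 3 \<in> H" "tr 1 4 \<circ> tr 5 6 \<in> H" "tr 2 3 \<circ> tr 5 6 \<in> H"
    and s: "s \<circ> s = id" "s \<in> {id, tr 5 6}"
    and m: "m \<in> T6" "m \<noteq> s6" "s \<circ> m \<circ> s \<in> s0_conjugates" and r: "r \<in> T6"
  shows "s \<circ> r \<circ> s \<in> s0_conjugates"
proof -
  let ?r2 = "tr 1 2 \<circ> tr 3 6 \<circ> tr 4 5 :: nat \<Rightarrow> nat" and ?r3 = "tr 1 3 \<circ> tr 2 5 \<circ> tr 4 6 :: nat \<Rightarrow> nat"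
    and ?r5 = "tr 1 5 \<circ> tr 2 6 \<circ> tr 3 4 :: nat \<Rightarrow> nat" and ?r6 = "tr 1 6 \<circ> tr 2 4 \<circ> tr 3 5 :: nat \<Rightarrow> nat"
  let ?e1 = "tr 1 4 \<circ> tr 2 3 :: nat \<Rightarrow> nat" and ?e2 = "tr 1 4 \<circ> tr 5 6 :: nat \<Rightarrow> nat"
    and ?e3 = "tr 2 3 \<circ> tr 5 6 :: nat \<Rightarrow> nat"
  let ?t = "tr 5 6 :: nat \<Rightarrow> nat"
  have "?t \<circ> ?e1 \<circ> ?t = ?e1" "?t \<circ> ?e2 \<circ> ?t = ?e2" "?t \<circ> ?e3 \<circ> ?t = ?e3" "?t \<circ> s6 \<circ> ?t = s6"
    by (rule perm_eqI6; auto simp: s6_def intro!: perm_intros; fail)+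
  then have sE: "s \<circ> ?e1 \<circ> s \<in> H" "s \<circ> ?e2 \<circ> s \<in> H" "s \<circ> ?e3 \<circ> s \<in> H" and s6: "s \<circ> s6 \<circ> s \<in> s0_conjugates"
    using s(2) E s0_conjugates_s0 s0 by auto
  note step = s0_conjugates_conj_mem[OF s(1) sE(1)] s0_conjugates_conj_mem[OF s(1) sE(2)] s0_conjugates_conj_mem[OF s(1) sE(3)]
  have conj: "?e3 \<circ> ?r3 = ?r2 \<circ> ?e3" "?e1 \<circ> ?r5 = ?r2 \<circ> ?e1" "?e2 \<circ> ?r6 = ?r2 \<circ> ?e2"
    "?e3 \<circ> ?r2 = ?r3 \<circ> ?e3" "?e1 \<circ> ?r2 = ?r5 \<circ> ?e1" "?e2 \<circ> ?r2 = ?r6 \<circ> ?e2"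
    by (rule perm_eqI6; auto intro!: perm_intros; fail)+
  have r2: "s \<circ> ?r2 \<circ> s \<in> s0_conjugates"
  proof -
    consider "m = ?r2" | "m = ?r3" | "m = ?r5" | "m = ?r6" using m(1,2) unfolding T6_def by blast
    then show ?thesis
      using m(3) step(3)[OF _ conj(1)] step(1)[OF _ conj(2)] step(2)[OF _ conj(3)] by cases simp_all
  qed
  show ?thesis
    using r r2 s6 step(3)[OF r2 conj(4)] step(1)[OF r2 conj(5)] step(2)[OF r2 conj(6)]
    unfolding T6_def by blast
qed

lemma exceptional_6_3:
  assumes n: "n = 6" and k: "k = 3" and s0: "s0 = s6"
  shows "isomorphic_decompositions (johnson 6 3) \<P> \<P>\<^sub>2"
proof -
  obtain m where m: "m \<in> s0_conjugates" "bad \<circ> s0 = m \<circ> bad" using s0_conjugates_conj[OF bad(1) s0_conjugates_s0] by blast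
  note pg = H_permutes[OF bad(1)]
  have mg: "m (bad x) = bad (s6 x)" for x using m(2) s0 by (metis comp_apply)
  have ginj: "bad a = bad b \<longleftrightarrow> a = b" for a b using permutes_inj[OF pg] by (auto dest: injD)
  have b: "s6 1 = 4" "s6 2 = 3" "s6 3 = 2" "s6 4 = 1" "s6 5 = 6" "s6 6 = 5" by (simp_all add: s6_def)
  have in6: "x \<in> {1, 2, 3, 4, 5, 6} \<longleftrightarrow> x \<in> {1..n}" for x by (auto simp: n)
  have fp: "m x \<noteq> x" if x: "x \<in> {1, 2, 3, 4, 5, 6}" for x
  proof -
    obtain w where w: "x = bad w" "w \<in> {1..n}"
      using x permutes_image[OF pg] unfolding in6 by blast
    have "s6 w \<noteq> w" using w(2) b unfolding in6[symmetric] by auto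
    then show ?thesis unfolding w(1) mg ginj .
  qed
  \<comment> \<open>Agreement would make \<open>bad\<close> commute with \<open>s6\<close>, hence
    keep \<open>5\<close> and \<open>6\<close> in one cell and be good.\<close>
  have ne: "m x \<noteq> s6 x" if "s6 x \<noteq> x" for x
  proof
    assume "m x = s6 x"
    then have "m = s6" using s0_conjugates_meets[OF m(1) s0_conjugates_s0, of x] s0 that by simp
    then have "bad 6 = s6 (bad 5)" using mg[of 5] b by simp
    moreover have "bad 5 \<in> {1..n}" "bad 6 \<in> {1..n}" using H_in[OF bad(1)] n by simp_all
    ultimately have "cell (bad 5) = cell (bad 6)" using s0_cell[of "bad 5" "bad 6"] s0 ginj[of 5 6] by simp
    then have "rel (bad 5) (bad 6)" using cell_rel \<open>bad 5 \<in> {1..n}\<close> \<open>bad 6 \<in> {1..n}\<close> by blast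
    moreover have "bad (n - 1) = bad 5" "bad n = bad 6" using n by simp_all
    ultimately show False using bad(2) unfolding good_def by simp
  qed
  have vals: "m x \<in> {1, 2, 3, 4, 5, 6}" if "x \<in> {1, 2, 3, 4, 5, 6}" for x
    using permutes_in_image[OF s0_conjugates_permutes[OF m(1)]] that unfolding in6 by blast
  have tuple: "(m 1, m 2, m 3, m 4, m 5, m 6) \<in> {(2,1,6,5,4,3), (3,5,1,6,2,4), (5,6,4,3,1,2), (6,4,5,2,3,1),
     (2,1,5,6,3,4), (3,6,1,5,4,2), (6,5,4,3,2,1), (5,4,6,2,1,3)}"
  proof (rule involution_6_cases)
    show "m 1 \<noteq> 4" "m 2 \<noteq> 3" "m 5 \<noteq> 6" using ne[of 1] ne[of 2] ne[of 5] b by auto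
  qed ((rule vals, simp; fail | rule fp, simp; fail | rule s0_conjugates_invol[OF m(1)])+)
  define t :: "nat \<Rightarrow> nat" where "t = tr 5 6"
  have pm: "m permutes {1..6}" using s0_conjugates_permutes[OF m(1)] n by simp
  have "\<exists>s \<in> {id, t}. \<exists>r \<in> T6. r \<noteq> s6 \<and> m = s \<circ> r \<circ> s"
  proof -
    let ?r2 = "tr 1 2 \<circ> tr 3 6 \<circ> tr 4 5" and ?r3 = "tr 1 3 \<circ> tr 2 5 \<circ> tr 4 6"
      and ?r5 = "tr 1 5 \<circ> tr 2 6 \<circ> tr 3 4" and ?r6 = "tr 1 6 \<circ> tr 2 4 \<circ> tr 3 5"
    have r: "?r2 \<in> T6" "?r3 \<in> T6" "?r5 \<in> T6" "?r6 \<in> T6" by (simp_all add: T6_def)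
    have "?r2 1 \<noteq> s6 1" "?r3 1 \<noteq> s6 1" "?r5 1 \<noteq> s6 1" "?r6 1 \<noteq> s6 1" by (simp_all add: s6_def)
    then have rb: "?r2 \<noteq> s6" "?r3 \<noteq> s6" "?r5 \<noteq> s6" "?r6 \<noteq> s6" by metis+
    have "m = id \<circ> ?r2 \<circ> id \<or> m = id \<circ> ?r3 \<circ> id \<or> m = id \<circ> ?r5 \<circ> id \<or> m = id \<circ> ?r6 \<circ> id \<or>
        m = t \<circ> ?r2 \<circ> t \<or> m = t \<circ> ?r3 \<circ> t \<or> m = t \<circ> ?r5 \<circ> t \<or> m = t \<circ> ?r6 \<circ> t"
      using tuple
    proof (elim insertE emptyE, goal_cases)
      case 1
      have "m = id \<circ> ?r2 \<circ> id" by (rule perm_eqI6[OF pm]) (use 1 in \<open>auto intro!: perm_intros\<close>)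
      then show ?case by blast
    next
      case 2
      have "m = id \<circ> ?r3 \<circ> id" by (rule perm_eqI6[OF pm]) (use 2 in \<open>auto intro!: perm_intros\<close>)
      then show ?case by blast
    next
      case 3
      have "m = id \<circ> ?r5 \<circ> id" by (rule perm_eqI6[OF pm]) (use 3 in \<open>auto intro!: perm_intros\<close>)
      then show ?case by blast
    next
      case 4
      have "m = id \<circ> ?r6 \<circ> id" by (rule perm_eqI6[OF pm]) (use 4 in \<open>auto intro!: perm_intros\<close>)
      then show ?case by blast
    next
      case 5
      have "m = t \<circ> ?r2 \<circ> t" by (rule perm_eqI6[OF pm]) (use 5 in \<open>auto simp: t_def intro!: perm_intros\<close>)
      then show ?case by blast
    next
      case 6
      have "m = t \<circ> ?r3 \<circ> t" by (rule perm_eqI6[OF pm]) (use 6 in \<open>auto simp: t_def intro!: perm_intros\<close>)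
      then show ?case by blast
    next
      case 7
      have "m = t \<circ> ?r5 \<circ> t" by (rule perm_eqI6[OF pm]) (use 7 in \<open>auto simp: t_def intro!: perm_intros\<close>)
      then show ?case by blast
    next
      case 8
      have "m = t \<circ> ?r6 \<circ> t" by (rule perm_eqI6[OF pm]) (use 8 in \<open>auto simp: t_def intro!: perm_intros\<close>)
      then show ?case by blast
    qed
    then show ?thesis
    proof (elim disjE)
    qed ((rule bexI[of _ id] bexI[of _ t], rule bexI, rule conjI[rotated], assumption, rule rb, rule r, simp)+)
  qed
  then obtain s where s: "s \<in> {id, t}" and "\<exists>r \<in> T6. r \<noteq> s6 \<and> m = s \<circ> r \<circ> s" by (rule bexE)
  then obtain r where "r \<in> T6" "r \<noteq> s6 \<and> m = s \<circ> r \<circ> s" by (elim bexE)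
  then have r: "r \<in> T6" "r \<noteq> s6" "m = s \<circ> r \<circ> s" by simp_all
  have c: "cell 1 = cell 4" "cell 2 = cell 3" "cell 5 = cell 6" unfolding cell_def unfolding k by simp_all
  have E: "tr 1 4 \<circ> tr 2 3 \<in> H" "tr 1 4 \<circ> tr 5 6 \<in> H" "tr 2 3 \<circ> tr 5 6 \<in> H"
    by (rule cell_tr_tr[OF _ _ _ _ _ _ c(1,2)] cell_tr_tr[OF _ _ _ _ _ _ c(1,3)] cell_tr_tr[OF _ _ _ _ _ _ c(2,3)];
      simp add: n; fail)+
  have s': "s permutes {1..n}" "s \<circ> s = id" "act s e0 = e0"
  proof -
    have "t permutes {1..n}" unfolding t_def by (rule permutes_swap_id) (simp_all add: n)
    moreover have "t \<circ> t = id" unfolding t_def by (rule transpose_comp_involutory)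
    moreover have "act t e0 = e0" unfolding t_def by (rule act_tr_e0[OF c(3)]) simp_all
    moreover have "s = id \<or> s = t" using s by blast
    ultimately show "s permutes {1..n}" "s \<circ> s = id" "act s e0 = e0"
      using permutes_id act_id id_comp by metis+
  qed
  have e0: "e0 = {{1, 2, 3}, {2, 3, 4}}"
  proof -
    have "{1..3} = {1, 2, 3 :: nat}" "{2..3 + 1} = {2, 3, 4 :: nat}" by auto
    then show ?thesis unfolding e0_def unfolding k by (simp only:)
  qed
  have "isomorphic_decompositions (johnson n k) \<P> (orbit (alt_group n) (part_act (johnson_act n k)) P\<^sub>2)"
  proof (rule isomorphic_if_cover[OF s', of T6 "H\<^sub>2"])
    show "s \<circ> r' \<circ> s \<in> s0_conjugates" if "r' \<in> T6" for r'
      using T6_conjugates[OF n s0 E s'(2) _ r(1,2) _ that] s r(3) m(1) by (simp add: t_def)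
    show "P\<^sub>2 = orbit H\<^sub>2 (edge_act (johnson_act n k)) e0" unfolding P\<^sub>2_def e0 unfolding n k by (rule refl)
  qed (simp_all add: n T6_pairs_covered H2_subgroup H2_ne_alt mem_H2)
  then show ?thesis by (simp add: \<P>\<^sub>2_def n k)
qed

end

lemma (in alt_primitive5) sym_primitive_or_exceptional:
  "primitive_decomposition (sym_group n) (johnson_act n k) (johnson n k) \<P> \<or>
    (n = 5 \<and> k = 2 \<and> isomorphic_decompositions (johnson 5 2) \<P> \<P>\<^sub>1) \<or>
    (n = 6 \<and> k = 3 \<and> isomorphic_decompositions (johnson 6 3) \<P> \<P>\<^sub>2)"
proof (cases "\<forall>h \<in> H. good h")
  case True
  then show ?thesis using sym_primitive_if_good by blast
next
  case False
  then obtain h where h: "h \<in> H" "\<not> good h" by blast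
  then have "n = k + 3" using good_if_large[OF _ h(1)] k3n by linarith
  then consider "n = 5" "k = 2" | "n = 6" "k = 3" using k2 n2k by linarith
  then show ?thesis
  proof cases
    case 1
    have pts: "{1..n} = {1, 2, 3, 4, 5}" using 1 by auto
    have "alt_primitive_bad n k \<P> b5 h"
    proof (intro alt_primitive_bad.intro alt_primitive_bad_axioms.intro alt_primitive5_axioms h)
      show "b5 permutes {1..n}" using perm5(2) 1 by simp
      show "b5 \<circ> b5 = id" by (rule perm_eqI5) (auto simp: b5_def intro!: perm_intros)
    next
      fix x y assume "x \<in> {1..n}" "y \<in> {1..n}" "x \<noteq> y"
      then show "cell x = cell y \<longleftrightarrow> y = b5 x"
        unfolding pts cell_def unfolding 1(2) by (elim insertE emptyE) (simp_all add: b5_def)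
    qed
    then show ?thesis using alt_primitive_bad.exceptional_5_2 1 by blast
  next
    case 2
    have pts: "{1..n} = {1, 2, 3, 4, 5, 6}" using 2 by auto
    have "alt_primitive_bad n k \<P> s6 h"
    proof (intro alt_primitive_bad.intro alt_primitive_bad_axioms.intro alt_primitive5_axioms h)
      show "s6 permutes {1..n}" using perm6(3) 2 by simp
      show "s6 \<circ> s6 = id" by (rule perm_eqI6) (auto simp: s6_def intro!: perm_intros)
    next
      fix x y assume "x \<in> {1..n}" "y \<in> {1..n}" "x \<noteq> y"
      then show "cell x = cell y \<longleftrightarrow> y = s6 x"
        unfolding pts cell_def unfolding 2(2) by (elim insertE emptyE) (simp_all add: s6_def)
    qed
    then show ?thesis using alt_primitive_bad.exceptional_6_3 2 by blast
  qed
qed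

section \<open>The action of the special linear group on the projective line over the field of order five\<close>

lemma Z5_exhaust: "(x :: 5) = 0 \<or> x = 1 \<or> x = 2 \<or> x = 3 \<or> x = 4"
proof (cases x)
  case (of_int z)
  then consider "z = 0" | "z = 1" | "z = 2" | "z = 3" | "z = 4" by fastforce
  then show ?thesis using of_int by cases simp_all
qed

lemma Z5_power4: "(x :: 5) \<noteq> 0 \<Longrightarrow> x ^ 4 = 1"
  using Z5_exhaust[of x] by auto

lemma Z5_mult_eq_0_iff: "(x :: 5) * y = 0 \<longleftrightarrow> x = 0 \<or> y = 0"
proof
  assume "x * y = 0"
  moreover have "x ^ 3 * (x * y) = x ^ 4 * y" by (simp add: power_numeral_reduce mult.assoc)
  ultimately show "x = 0 \<or> y = 0" using Z5_power4[of x] by (cases "x = 0") simp_all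
qed auto

text \<open>The points of the projective line are labelled so that the image of the special linear group
  is \<open>H\<^sub>2\<close>; the point at infinity is \<open>2\<close>.  The pair of \<open>rx i\<close> and \<open>ry i\<close> represents the point \<open>i\<close>.  The
  numeral type is not an instance of the class of fields, so the third power serves as the inverse.\<close>

definition lab :: "5 \<Rightarrow> nat" where
  "lab t = (if t = 0 then 3 else if t = 1 then 5 else if t = 2 then 1 else if t = 3 then 4 else 6)"

text \<open>As \<open>y ^ 3\<close> inverts a nonzero \<open>y\<close>, the affine coordinate is the
  quotient of \<open>x\<close> by \<open>y\<close>. The pair of zeros falls to infinity, which lets
  \<open>pt_scale\<close> hold for all pairs.\<close>

definition pt :: "5 \<Rightarrow> 5 \<Rightarrow> nat" where
  "pt x y = (if y = 0 then 2 else lab (x * y ^ 3))"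

text \<open>The final default serves \<open>5\<close>, the point at infinity \<open>2\<close> and
  all numbers outside the six points, so that the representing pair is never zero.\<close>

definition rx :: "nat \<Rightarrow> 5" where
  "rx i = (if i = 1 then 2 else if i = 4 then 3 else if i = 6 then 4 else if i = 3 then 0 else 1)"

definition ry :: "nat \<Rightarrow> 5" where
  "ry i = (if i = 2 then 0 else 1)"

lemma rx_ry_lab: "rx (lab t) = t" "ry (lab t) = 1"
  using Z5_exhaust[of t] by (auto simp: rx_def ry_def lab_def)

lemma rep_nonzero: "rx i \<noteq> 0 \<or> ry i \<noteq> 0"
  by (simp add: rx_def ry_def)

lemma pt_range: "pt x y \<in> {1..6}"
  by (auto simp: pt_def lab_def)

lemma pt_rep: "i \<in> {1..6} \<Longrightarrow> pt (rx i) (ry i) = i"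
proof -
  assume "i \<in> {1..6}"
  then have "i = 1 \<or> i = 2 \<or> i = 3 \<or> i = 4 \<or> i = 5 \<or> i = 6" by fastforce
  then show ?thesis by (auto simp: pt_def rx_def ry_def lab_def)
qed

lemma pt_scale:
  assumes "u \<noteq> 0" shows "pt (u * x) (u * y) = pt x y"
proof (cases "y = 0")
  case False
  have "(u * x) * (u * y) ^ 3 = u ^ 4 * (x * y ^ 3)"
    by (simp add: power_mult_distrib power_numeral_reduce mult_ac)
  then show ?thesis using False assms by (simp add: pt_def Z5_mult_eq_0_iff Z5_power4)
qed (simp add: pt_def)

lemma rep_pt:
  assumes "x \<noteq> 0 \<or> y \<noteq> 0"
  shows "\<exists>u. u \<noteq> 0 \<and> rx (pt x y) = u * x \<and> ry (pt x y) = u * y"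
proof (cases "y = 0")
  case True
  then have x: "x \<noteq> 0" using assms by blast
  have "x ^ 3 \<noteq> 0" "x ^ 3 * x = 1"
    using x Z5_power4[OF x] by (auto simp: power_numeral_reduce Z5_mult_eq_0_iff mult_ac)
  then show ?thesis using True by (intro exI[of _ "x ^ 3"]) (auto simp: pt_def rx_def ry_def)
next
  case False
  have "y ^ 3 \<noteq> 0" "y ^ 3 * y = 1"
    using False Z5_power4[OF False] by (auto simp: power_numeral_reduce Z5_mult_eq_0_iff mult_ac)
  then show ?thesis using False by (intro exI[of _ "y ^ 3"]) (auto simp: pt_def rx_ry_lab mult.commute)
qed

section \<open>Linear fractional maps, their image and kernel\<close>

definition psi :: "5 ^ 2 ^ 2 \<Rightarrow> nat \<Rightarrow> nat" where
  "psi A i = (if i \<in> {1..6} then pt (A $ 1 $ 1 * rx i + A $ 1 $ 2 * ry i) (A $ 2 $ 1 * rx i + A $ 2 $ 2 * ry i) else i)"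

lemma mult_entry: "((A :: 5 ^ 2 ^ 2) ** B) $ i $ j = A $ i $ 1 * B $ 1 $ j + A $ i $ 2 * B $ 2 $ j"
  by (simp add: matrix_matrix_mult_def sum_2)

lemma mat2_eq_iff: "(A :: 5 ^ 2 ^ 2) = B \<longleftrightarrow> A $ 1 $ 1 = B $ 1 $ 1 \<and> A $ 1 $ 2 = B $ 1 $ 2 \<and> A $ 2 $ 1 = B $ 2 $ 1 \<and> A $ 2 $ 2 = B $ 2 $ 2"
  by (auto simp: vec_eq_iff forall_2)

definition mat2 :: "5 \<Rightarrow> 5 \<Rightarrow> 5 \<Rightarrow> 5 \<Rightarrow> 5 ^ 2 ^ 2" where
  "mat2 a b c d = vector [vector [a, b], vector [c, d]]"

lemma mat2_entries [simp]: "mat2 a b c d $ 1 $ 1 = a" "mat2 a b c d $ 1 $ 2 = b" "mat2 a b c d $ 2 $ 1 = c" "mat2 a b c d $ 2 $ 2 = d"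
  by (simp_all add: mat2_def)

abbreviation SL25 :: "(5 ^ 2 ^ 2) monoid" where "SL25 \<equiv> SL"

lemma SL_carrier: "A \<in> carrier SL25 \<longleftrightarrow> A $ 1 $ 1 * A $ 2 $ 2 - A $ 1 $ 2 * A $ 2 $ 1 = 1"
  by (simp add: SL_def det_2)

lemma SL_mult: "A \<otimes>\<^bsub>SL25\<^esub> B = A ** B"
  by (simp add: SL_def)

lemma SL_one: "\<one>\<^bsub>SL25\<^esub> = mat 1"
  by (simp add: SL_def)

lemma mat_1_entries: "(mat 1 :: 5 ^ 2 ^ 2) $ 1 $ 1 = 1" "(mat 1 :: 5 ^ 2 ^ 2) $ 1 $ 2 = 0"
  "(mat 1 :: 5 ^ 2 ^ 2) $ 2 $ 1 = 0" "(mat 1 :: 5 ^ 2 ^ 2) $ 2 $ 2 = 1"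
  by (simp_all add: mat_def)

lemma SL_closed: "A \<in> carrier SL25 \<Longrightarrow> B \<in> carrier SL25 \<Longrightarrow> A ** B \<in> carrier SL25"
  by (simp add: SL_def det_mul)

lemma SL_group: "group SL25"
proof (rule groupI)
  fix A :: "5 ^ 2 ^ 2" assume A: "A \<in> carrier SL25"
  let ?B = "mat2 (A $ 2 $ 2) (- (A $ 1 $ 2)) (- (A $ 2 $ 1)) (A $ 1 $ 1)"
  have "?B \<in> carrier SL25" using A by (simp add: SL_carrier mult.commute)
  moreover have "?B \<otimes>\<^bsub>SL25\<^esub> A = \<one>\<^bsub>SL25\<^esub>"
    using A by (simp add: SL_carrier SL_mult SL_one mat2_eq_iff mult_entry mat_1_entries algebra_simps)
  ultimately show "\<exists>B\<in>carrier SL25. B \<otimes>\<^bsub>SL25\<^esub> A = \<one>\<^bsub>SL25\<^esub>" by blast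
next
  show "\<one>\<^bsub>SL25\<^esub> \<in> carrier SL25" by (simp add: SL_def)
qed (simp_all add: SL_mult SL_one SL_closed matrix_mul_assoc)

text \<open>The chosen representative of \<open>psi B i\<close> is a nonzero multiple of
  \<open>B\<close> applied to that of \<open>i\<close>, and the factor cancels under
  \<open>A\<close>. Invertibility of \<open>B\<close> keeps the intermediate vector nonzero.\<close>

lemma psi_comp:
  assumes B: "B \<in> carrier SL25"
  shows "psi (A ** B) = psi A \<circ> psi B"
proof
  fix i
  show "psi (A ** B) i = (psi A \<circ> psi B) i"
  proof (cases "i \<in> {1..6}")
    case True
    define p where "p = B $ 1 $ 1 * rx i + B $ 1 $ 2 * ry i"
    define q where "q = B $ 2 $ 1 * rx i + B $ 2 $ 2 * ry i"
    have det: "B $ 1 $ 1 * B $ 2 $ 2 - B $ 1 $ 2 * B $ 2 $ 1 = 1" using B by (simp add: SL_carrier)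
    \<comment> \<open>Cramer's rule: \<open>p\<close> and \<open>q\<close> both zero would force
      \<open>rx i\<close> and \<open>ry i\<close> to vanish.\<close>
    have "B $ 2 $ 2 * p - B $ 1 $ 2 * q = (B $ 1 $ 1 * B $ 2 $ 2 - B $ 1 $ 2 * B $ 2 $ 1) * rx i"
      "B $ 1 $ 1 * q - B $ 2 $ 1 * p = (B $ 1 $ 1 * B $ 2 $ 2 - B $ 1 $ 2 * B $ 2 $ 1) * ry i"
      by (simp_all add: p_def q_def algebra_simps)
    then have "p \<noteq> 0 \<or> q \<noteq> 0" using rep_nonzero[of i] det by auto
    then obtain u where u: "u \<noteq> 0" "rx (pt p q) = u * p" "ry (pt p q) = u * q" using rep_pt by blast
    have "psi B i = pt p q" using True by (simp add: psi_def p_def q_def)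
    then have "psi A (psi B i) = pt (A $ 1 $ 1 * (u * p) + A $ 1 $ 2 * (u * q)) (A $ 2 $ 1 * (u * p) + A $ 2 $ 2 * (u * q))"
      using pt_range[of p q] by (simp add: psi_def u)
    also have "\<dots> = pt (u * (A $ 1 $ 1 * p + A $ 1 $ 2 * q)) (u * (A $ 2 $ 1 * p + A $ 2 $ 2 * q))"
      by (simp add: algebra_simps)
    also have "\<dots> = pt (A $ 1 $ 1 * p + A $ 1 $ 2 * q) (A $ 2 $ 1 * p + A $ 2 $ 2 * q)"
      by (rule pt_scale[OF u(1)])
    also have "\<dots> = psi (A ** B) i"
      using True by (simp add: psi_def mult_entry p_def q_def algebra_simps)
    finally show ?thesis by simp
  next
    case False
    then have "psi C i = i" for C by (simp only: psi_def if_False)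
    then show ?thesis by simp
  qed
qed

lemma psi_scalar:
  assumes "A $ 1 $ 2 = 0" "A $ 2 $ 1 = 0" "A $ 1 $ 1 = A $ 2 $ 2" "A $ 2 $ 2 \<noteq> 0"
  shows "psi A = id"
proof
  fix i show "psi A i = id i"
    using assms pt_scale[OF assms(4), of "rx i" "ry i"] pt_rep[of i] by (simp add: psi_def)
qed

lemma psi_one: "psi (mat 1) = id"
  by (rule psi_scalar) (simp_all add: mat_1_entries)

lemma psi_permutes: assumes "A \<in> carrier SL25" shows "psi A permutes {1..6}"
proof -
  interpret group SL25 by (rule SL_group)
  let ?B = "inv\<^bsub>SL25\<^esub> A"
  have B: "?B \<in> carrier SL25" "?B ** A = mat 1" "A ** ?B = mat 1"
    using assms l_inv[of A] r_inv[of A] by (simp_all add: SL_mult SL_one)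
  have "psi A \<circ> psi ?B = id" "psi ?B \<circ> psi A = id"
    using psi_comp[OF B(1), of A] psi_comp[OF assms, of ?B] B psi_one by simp_all
  then have "bij (psi A)" by (rule o_bij[rotated])
  moreover have "psi A x = x" if "x \<notin> {1..6}" for x using that by (simp only: psi_def if_False)
  ultimately show ?thesis unfolding permutes_def by (metis bij_pointE)
qed

lemma psi_hom: "group_hom SL25 (sym_group 6) psi"
  by (intro group_hom.intro group_hom_axioms.intro homI SL_group sym_group_is_group)
    (simp_all only: sym_group_carrier psi_permutes SL_mult sym_group_mult psi_comp)

text \<open>As \<open>4\<close> is \<open>-1\<close>, the four matrices act on the line as -1/z,
  -1/(z+1), z+1 and z/(z+1).\<close>

lemma psi_gens: "psi (mat2 0 1 4 0) = a6" "psi (mat2 0 1 4 4) = b6"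
  "psi (mat2 1 1 0 1) = a6 \<circ> b6" "psi (mat2 1 0 1 1) = a6 \<circ> (b6 \<circ> b6)"
  by (rule perm_eqI6; (intro psi_permutes perm_intros perm6)?;
      simp add: SL_carrier psi_def pt_def lab_def rx_def ry_def a6_def b6_def; fail)+

lemma psi_upper: "psi (mat2 1 x 0 1) \<in> carrier H\<^sub>2"
proof -
  have U: "mat2 1 1 0 1 \<in> carrier SL25" by (simp add: SL_carrier)
  have step: "psi (mat2 1 (y + 1) 0 1) \<in> carrier H\<^sub>2" if "psi (mat2 1 y 0 1) \<in> carrier H\<^sub>2" for y
  proof -
    have "mat2 1 (y + 1) 0 1 = mat2 1 y 0 1 ** mat2 1 1 0 1" by (simp add: mat2_eq_iff mult_entry add.commute)
    then show ?thesis using psi_comp[OF U] that H2_mem psi_gens(3) by simp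
  qed
  have "psi (mat2 1 0 0 1) \<in> carrier H\<^sub>2" using psi_scalar[of "mat2 1 0 0 1"] H2_mem(3) by simp
  then have "psi (mat2 1 (0 + 1) 0 1) \<in> carrier H\<^sub>2" "psi (mat2 1 (0 + 1 + 1) 0 1) \<in> carrier H\<^sub>2"
    "psi (mat2 1 (0 + 1 + 1 + 1) 0 1) \<in> carrier H\<^sub>2" "psi (mat2 1 (0 + 1 + 1 + 1 + 1) 0 1) \<in> carrier H\<^sub>2"
    using step by blast+
  then show ?thesis using Z5_exhaust[of x] \<open>psi (mat2 1 0 0 1) \<in> carrier H\<^sub>2\<close> by auto
qed

lemma psi_lower: "psi (mat2 1 0 x 1) \<in> carrier H\<^sub>2"
proof -
  have L: "mat2 1 0 1 1 \<in> carrier SL25" by (simp add: SL_carrier)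
  have step: "psi (mat2 1 0 (y + 1) 1) \<in> carrier H\<^sub>2" if "psi (mat2 1 0 y 1) \<in> carrier H\<^sub>2" for y
  proof -
    have "mat2 1 0 (y + 1) 1 = mat2 1 0 y 1 ** mat2 1 0 1 1" by (simp add: mat2_eq_iff mult_entry add.commute)
    then show ?thesis using psi_comp[OF L] that H2_mem psi_gens(4) by simp
  qed
  have "psi (mat2 1 0 0 1) \<in> carrier H\<^sub>2" using psi_scalar[of "mat2 1 0 0 1"] H2_mem(3) by simp
  then have "psi (mat2 1 0 (0 + 1) 1) \<in> carrier H\<^sub>2" "psi (mat2 1 0 (0 + 1 + 1) 1) \<in> carrier H\<^sub>2"
    "psi (mat2 1 0 (0 + 1 + 1 + 1) 1) \<in> carrier H\<^sub>2" "psi (mat2 1 0 (0 + 1 + 1 + 1 + 1) 1) \<in> carrier H\<^sub>2"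
    using step by blast+
  then show ?thesis using Z5_exhaust[of x] \<open>psi (mat2 1 0 0 1) \<in> carrier H\<^sub>2\<close> by auto
qed

text \<open>The upper and lower transvections generate the special linear group, and their images
  lie in \<open>H\<^sub>2\<close>.\<close>

lemma psi_H2: assumes A: "A \<in> carrier SL25" shows "psi A \<in> carrier H\<^sub>2"
proof -
  have nz: "psi A \<in> carrier H\<^sub>2" if A: "A \<in> carrier SL25" and c: "A $ 2 $ 1 \<noteq> 0" for A
  proof -
    define c where "c = A $ 2 $ 1"
    \<comment> \<open>These entries solve \<open>A = U(x) L(c) U(y)\<close> with \<open>U\<close>
      upper and \<open>L\<close> lower unitriangular: the diagonal gives \<open>x\<close> and
      \<open>y\<close>, and determinant one gives the remaining entry.\<close>
    define x where "x = (A $ 1 $ 1 - 1) * c ^ 3"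
    define y where "y = (A $ 2 $ 2 - 1) * c ^ 3"
    have cc: "c ^ 3 * c = 1" using Z5_power4[of c] c by (simp add: c_def power_numeral_reduce mult_ac)
    have xc: "x * c = A $ 1 $ 1 - 1" and cy: "c * y = A $ 2 $ 2 - 1"
    proof -
      have "x * c = (A $ 1 $ 1 - 1) * (c ^ 3 * c)" "c * y = (A $ 2 $ 2 - 1) * (c ^ 3 * c)"
        by (simp_all only: x_def y_def mult_ac)
      then show "x * c = A $ 1 $ 1 - 1" "c * y = A $ 2 $ 2 - 1" by (simp_all add: cc)
    qed
    have "x + (1 + x * c) * y = A $ 1 $ 2"
    proof -
      have "c * (x + (1 + x * c) * y) = x * c + (1 + x * c) * (c * y)" by (simp add: algebra_simps)
      also have "\<dots> = A $ 1 $ 1 * A $ 2 $ 2 - 1" unfolding xc cy by (simp add: algebra_simps)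
      also have "\<dots> = c * A $ 1 $ 2" using A by (simp add: SL_carrier c_def algebra_simps)
      finally have "c ^ 3 * c * (x + (1 + x * c) * y) = c ^ 3 * c * A $ 1 $ 2" by (simp add: mult.assoc)
      then show ?thesis by (simp add: cc)
    qed
    then have "A $ 1 $ 2 = y + x * (c * y + 1)" by (simp add: algebra_simps)
    moreover have "A $ 1 $ 1 = 1 + x * c" "A $ 2 $ 1 = c" "A $ 2 $ 2 = c * y + 1"
      unfolding xc cy by (simp_all add: c_def)
    ultimately have "A = mat2 1 x 0 1 ** (mat2 1 0 c 1 ** mat2 1 y 0 1)"
      by (simp only: mat2_eq_iff mult_entry mat2_entries) simp
    moreover have "mat2 1 y 0 1 \<in> carrier SL25" "mat2 1 0 c 1 \<in> carrier SL25" by (simp_all add: SL_carrier)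
    ultimately have "psi A = psi (mat2 1 x 0 1) \<circ> (psi (mat2 1 0 c 1) \<circ> psi (mat2 1 y 0 1))"
      using psi_comp SL_closed by metis
    then show ?thesis using psi_upper psi_lower H2_mem(4) by metis
  qed
  show ?thesis
  proof (cases "A $ 2 $ 1 = 0")
    case True
    let ?L = "mat2 1 0 1 1"
    have "A $ 1 $ 1 \<noteq> 0" using A True by (auto simp: SL_carrier)
    \<comment> \<open>For vanishing lower left entry, \<open>?L\<close> puts the nonzero
      \<open>A $ 1 $ 1\<close> in its place.\<close>
    then have "(?L ** A) $ 2 $ 1 \<noteq> 0" using True by (simp add: mult_entry)
    moreover have "?L ** A \<in> carrier SL25" using A by (intro SL_closed) (simp_all add: SL_carrier)
    ultimately have "psi ?L \<circ> psi A \<in> carrier H\<^sub>2" using nz psi_comp[OF A] by metis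
    then show ?thesis using generated_cancel psi_lower[of 1] unfolding H2_eq by blast
  qed (use nz A in blast)
qed

lemma psi_image: "psi ` carrier SL25 = carrier H\<^sub>2"
proof
  show "psi ` carrier SL25 \<subseteq> carrier H\<^sub>2" using psi_H2 by blast
  interpret group_hom SL25 "sym_group 6" psi by (rule psi_hom)
  have "{a6, b6} \<subseteq> psi ` carrier SL25"
    using psi_gens(1,2) by (auto simp: SL_carrier intro!: image_eqI[of a6 psi "mat2 0 1 4 0"] image_eqI[of b6 psi "mat2 0 1 4 4"])
  then show "carrier H\<^sub>2 \<subseteq> psi ` carrier SL25"
    unfolding H2_eq using H.subgroup_generated_minimal img_is_subgroup by blast
qed

text \<open>Both sides are the scalar matrices of determinant one: a map fixing infinity, zero and
  one is scalar, and so is a matrix commuting with an upper and a lower transvection.\<close>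

lemma psi_kernel: "kernel SL25 H\<^sub>2 psi = group_center SL25"
proof -
  have scalar: "A $ 1 $ 2 = 0 \<and> A $ 2 $ 1 = 0 \<and> A $ 1 $ 1 = A $ 2 $ 2"
    if A: "A \<in> carrier SL25" and id: "psi A = id" for A
  proof -
    have "psi A 2 = 2" "psi A 3 = 3" "psi A 5 = 5" using id by simp_all
    then have p: "pt (A $ 1 $ 1) (A $ 2 $ 1) = 2" "pt (A $ 1 $ 2) (A $ 2 $ 2) = 3"
      "pt (A $ 1 $ 1 + A $ 1 $ 2) (A $ 2 $ 1 + A $ 2 $ 2) = 5"
      by (simp_all add: psi_def rx_def ry_def)
    have lab2: "lab t \<noteq> 2" "lab t = 3 \<longleftrightarrow> t = 0" "lab t = 5 \<longleftrightarrow> t = 1" for t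
      by (simp_all add: lab_def)
    have c: "A $ 2 $ 1 = 0" using p(1) lab2 by (simp add: pt_def split: if_splits)
    then have ad: "A $ 1 $ 1 * A $ 2 $ 2 = 1" using A by (simp add: SL_carrier)
    then have d: "A $ 2 $ 2 \<noteq> 0" by auto
    have "A $ 1 $ 2 * A $ 2 $ 2 ^ 3 = 0" using p(2) d lab2 by (simp add: pt_def)
    then have b: "A $ 1 $ 2 = 0" using d by (simp add: Z5_mult_eq_0_iff power_numeral_reduce)
    have "A $ 1 $ 1 * A $ 2 $ 2 ^ 3 = 1" using p(3) b c d lab2 by (simp add: pt_def)
    then have "A $ 1 $ 1 = A $ 2 $ 2"
      using ad Z5_exhaust[of "A $ 1 $ 1"] Z5_exhaust[of "A $ 2 $ 2"] by auto
    then show ?thesis using b c by blast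
  qed
  have center: "A $ 1 $ 2 = 0 \<and> A $ 2 $ 1 = 0 \<and> A $ 1 $ 1 = A $ 2 $ 2"
    if A: "A \<in> group_center SL25" for A
  proof -
    have "mat2 1 1 0 1 \<in> carrier SL25" "mat2 1 0 1 1 \<in> carrier SL25" by (simp_all add: SL_carrier)
    then have "A ** mat2 1 1 0 1 = mat2 1 1 0 1 ** A" "A ** mat2 1 0 1 1 = mat2 1 0 1 1 ** A"
      using A by (simp_all add: group_center_def SL_mult)
    then show ?thesis by (simp add: mat2_eq_iff mult_entry)
  qed
  show ?thesis
  proof
    show "kernel SL25 H\<^sub>2 psi \<subseteq> group_center SL25"
    proof
      fix A assume "A \<in> kernel SL25 H\<^sub>2 psi"
      then have A: "A \<in> carrier SL25" "psi A = id" by (simp_all add: kernel_def H2_eq sym_group_one)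
      then show "A \<in> group_center SL25"
        using scalar[OF A] by (simp add: group_center_def SL_mult mat2_eq_iff mult_entry mult.commute)
    qed
    show "group_center SL25 \<subseteq> kernel SL25 H\<^sub>2 psi"
    proof
      fix A assume A: "A \<in> group_center SL25"
      then have AS: "A \<in> carrier SL25" by (simp add: group_center_def)
      then have "A $ 2 $ 2 \<noteq> 0" using center[OF A] by (auto simp: SL_carrier)
      then show "A \<in> kernel SL25 H\<^sub>2 psi"
        using AS center[OF A] psi_scalar[of A] by (simp add: kernel_def H2_eq sym_group_one)
    qed
  qed
qed

lemma H2_iso_PSL: "H\<^sub>2 \<cong> PSL_2_5"
proof -
  interpret S: group "sym_group 6" by (rule sym_group_is_group)
  have "psi \<in> hom SL25 H\<^sub>2"
    by (rule homI) (simp_all add: psi_H2, simp add: psi_comp SL_mult H2_eq sym_group_mult)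
  moreover have "group H\<^sub>2" unfolding H2_eq by (rule S.group_subgroup_generated)
  ultimately interpret group_hom SL25 "H\<^sub>2" psi
    by (simp add: group_hom_def group_hom_axioms_def SL_group)
  have "SL25 Mod (kernel SL25 H\<^sub>2 psi) \<cong> H\<^sub>2" by (rule FactGroup_iso[OF psi_image])
  moreover have "group (SL25 Mod (kernel SL25 H\<^sub>2 psi))"
    by (rule normal.factorgroup_is_group[OF normal_kernel])
  ultimately show ?thesis
    unfolding PSL_def psi_kernel[symmetric] by (rule group.iso_sym[rotated])
qed

section \<open>The theorem\<close>

text \<open>\<open>J(4, 2)\<close> has \<open>24\<close> arcs, too many for \<open>A\<^sub>4\<close>.\<close>

lemma (in alt_primitive) n_ne_4: "n \<noteq> 4"
proof
  assume n: "n = 4"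
  then have k: "k = 2" using k2 n2k by linarith
  have eq: "{1..2} = {1, 2 :: nat}" "{2..2 + 1} = {2, 3 :: nat}" by auto
  have e: "{{1, 2}, {2, 3}} \<in> edges (johnson 4 2)"
    using e0_edge unfolding e0_def unfolding n k eq .
  then have v: "{1, 2} \<in> verts (johnson 4 2)" "{2, 3} \<in> verts (johnson 4 2)"
    using edge_subset_verts by blast+
  have "{1, 2} \<noteq> {2, 3 :: nat}" by (simp add: doubleton_eq_iff)
  then have arcs: "({1, 2}, {2, 3}) \<in> arcs (johnson 4 2)" "({2, 3}, {1, 2}) \<in> arcs (johnson 4 2)"
    using e v by (auto simp: arcs_def insert_commute)
  have "arc_transitive (alt_group 4) (johnson_act 4 2) (johnson 4 2)"
    using arc_trans unfolding n k .
  \<comment> \<open>Reversing this arc forces \<open>p\<close> to fix \<open>2\<close>, exchange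
    \<open>1\<close> and \<open>3\<close> and therefore fix \<open>4\<close>; that is the odd
    \<open>tr 1 3\<close>.\<close>
  then obtain p where p: "p \<in> carrier (alt_group 4)" "johnson_act 4 2 p {1, 2} = {2, 3}"
    "johnson_act 4 2 p {2, 3} = {1, 2}"
    using arcs unfolding arc_transitive_def by fastforce
  then have im: "{p 1, p 2} = {2, 3}" "{p 2, p 3} = {1, 2}"
    using v by (simp_all add: johnson_act_def)
  have "p 2 \<in> {2, 3}" "p 2 \<in> {1, 2}" unfolding im[symmetric] by simp_all
  then have p2: "p 2 = 2" by force
  then have p123: "p 2 = 2" "p 1 = 3" "p 3 = 1" using im unfolding doubleton_eq_iff by simp_all
  have pp: "p permutes {1..4}" "evenperm p" using p(1) unfolding alt_group_carrier by blast+
  have inj: "p x = p y \<longleftrightarrow> x = y" for x y using permutes_inj[OF pp(1)] by (simp add: inj_eq)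
  have "p 4 \<in> {1..4}" using permutes_in_image[OF pp(1), of 4] by simp
  moreover have "p 4 \<noteq> 1" "p 4 \<noteq> 2" "p 4 \<noteq> 3"
    using inj[of 4 3] inj[of 4 2] inj[of 4 1] p123 by simp_all
  ultimately have p4: "p 4 = 4" by simp
  have "p x = tr 1 3 x" for x
  proof -
    consider "x \<notin> {1..4}" | "x = 1" | "x = 2" | "x = 3" | "x = 4" by fastforce
    then show ?thesis
    proof cases
      case 1
      then show ?thesis using permutes_not_in[OF pp(1) 1] by (auto simp: Transposition.transpose_def)
    qed (simp_all add: p123 p4)
  qed
  then have "p = tr 1 3" by blast
  then show False using pp(2) by (simp add: evenperm_swap)
qed

theorem theorem4p5:
  fixes n k :: nat and \<P> :: "nat set set set set"
  assumes "2 \<le> k" and "2 * k \<le> n"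
    and "primitive_decomposition (alt_group n) (johnson_act n k) (johnson n k) \<P>"
    and "arc_transitive (alt_group n) (johnson_act n k) (johnson n k)"
  shows "primitive_decomposition (sym_group n) (johnson_act n k) (johnson n k) \<P> \<or>
    (n = 5 \<and> k = 2 \<and> isomorphic_decompositions (johnson 5 2) \<P> \<P>\<^sub>1) \<or>
    (n = 6 \<and> k = 3 \<and> isomorphic_decompositions (johnson 6 3) \<P> \<P>\<^sub>2 \<and> H\<^sub>2 \<cong> PSL_2_5)"
proof -
  interpret alt_primitive n k \<P> using assms by unfold_locales
  have "5 \<le> n" using k2 n2k n_ne_4 by linarith
  then interpret alt_primitive5 n k \<P> by unfold_locales
  show ?thesis using sym_primitive_or_exceptional H2_iso_PSL by blast
qed

end
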